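(* Let $\mu=(\mu_1,\dots,\mu_d)'$ be the vector of market weights and $A=(A_1,\dots,A_d)'\in CBV([0,T],\mathbb{R}^d)$, such that every $\mu_i$ and every $X_i:=\mu_i-A_i$ has a continuous local time along $\mathbb{T}$. For $i=1,\dots,d$ let $f_i:\mathbb{R}\to\mathbb{R}$ be absolutely continuous with right-continuous Radon–Nikodým derivative $f_i'$ of finite variation, let $G(\mu(t),A(t)):=\sum_{i=1}^df_i(\mu_i(t)-A_i(t))$, $\vartheta_i(t):=f_i'(X_i(t))$, and assume that $1/G(\mu(\cdot),A(\cdot))$ is locally bounded. Let $\psi=(\psi_1,\dots,\psi_d)'$ be the trading strategy multiplicatively generated by $G$. Then $$V^\psi(t):=\sum_{i=1}^d\psi_i(t)\mu_i(t)=G(\mu(t),A(t))\exp\Big(\int_0^t\frac{d\Gamma^G(s)}{G(\mu(s),A(s))}\Big)>0,\qquad0\le t\le T,$$ and for $i=1,\dots,d$ and $0\le t\le T$, $$\psi_i(t)=V^\psi(t)\bigg(1+\frac{1}{G(\mu(t),A(t))}\Big(\vartheta_i(t)-\sum_{j=1}^d\vartheta_j(t)\mu_j(t)\Big)\bigg).$$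
   Context: Partitions: $T>0$ is fixed, and $\mathbb{T}=(\mathbb{T}_n)_{n\in\mathbb{N}}$ is a fixed sequence of finite partitions of $[0,T]$ (containing $0$ and $T$) with $\mathbb{T}_1\subset\mathbb{T}_2\subset\cdots$ and mesh tending to $0$. $[t_j,t_{j+1}]\in\mathbb{T}_n$ means that $t_j<t_{j+1}$ are consecutive points of $\mathbb{T}_n$; in sums over $[t_j,t_{j+1}]\in\mathbb{T}_n$ with $t_j\le t$, $t_{j+1}$ is replaced by $t$ when $j$ is the largest index with $t_j\le t$. Market weights: $S_1,\dots,S_d:[0,T]\to[0,\infty)$ ($d\ge2$) are continuous with $S_i(0)>0$ and $S_1(t)+\dots+S_d(t)>0$ for all $t$; $\mu_i(t)=S_i(t)/(S_1(t)+\dots+S_d(t))$. Each $\mu_i$ is assumed to have finite quadratic variation along $\mathbb{T}$: $\sum_{[t_j,t_{j+1}]\in\mathbb{T}_n,\,t_j\le t}|\mu_i(t_{j+1})-\mu_i(t_j)|^2$ converges for every $t$ to a limit $\langle\mu_i\rangle(t)$ that is continuous in $t$. $CBV([0,T],\mathbb{R}^d)$ denotes the continuous $\mathbb{R}^d$-valued functions of bounded variation on $[0,T]$. Continuous local time: write $I(a,b)=(a,b]$ if $a\le b$ and $I(a,b)=(b,a]$ if $b\le a$. For continuous $Y:[0,T]\to\mathbb{R}$ let $L^{Y,\mathbb{T}_n}_t(x)=\sum_{[t_j,t_{j+1}]\in\mathbb{T}_n,\,t_j\le t}\mathbf{1}_{I(Y(t_j),Y(t_{j+1}))}(x)|Y(t_{j+1})-x|$.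 $Y$ has a continuous local time along $\mathbb{T}$ if for every $t$ the functions $L^{Y,\mathbb{T}_n}_t(\cdot)$ converge uniformly to a continuous limit $L^Y_t(\cdot)$ and $(t,x)\mapsto L^Y_t(x)$ is jointly continuous. Integrals: $\int_0^t\vartheta_i(s)\,dA_i(s)$ and $\int_0^t\vartheta_i(s)\,d\mu_i(s)$ denote the limits as $n\to\infty$ of $\sum_{[t_j,t_{j+1}]\in\mathbb{T}_n,\,t_j\le t}\vartheta_i(t_j)(A_i(t_{j+1})-A_i(t_j))$ and $\sum_{[t_j,t_{j+1}]\in\mathbb{T}_n,\,t_j\le t}\vartheta_i(t_j)(\mu_i(t_{j+1})-\mu_i(t_j))$. The first limit exists because $A\in CBV([0,T],\mathbb{R}^d)$; since the corresponding limit with increments of $X_i=\mu_i-A_i$ exists by the pathwise Tanaka formula $f_i(X_i(t))-f_i(X_i(0))=\int_0^tf_i'(X_i(s))\,dX_i(s)+\int_{\mathbb{R}}L^{X_i}_t(x)\,df_i'(x)$, the second limit exists as well. Likewise $\sum_{i=1}^d\int_0^t\eta_i(s)\,d\mu_i(s):=\lim_n\sum_{i=1}^d\sum_{[t_j,t_{j+1}]\in\mathbb{T}_n,\,t_j\le t}\eta_i(t_j)(\mu_i(t_{j+1})-\mu_i(t_j))$ for $\eta$ below. Gamma function: $\Gamma^G(t):=G(\mu(0),A(0))-G(\mu(t),A(t))+\sum_{i=1}^d\int_0^t\vartheta_i(s)\,d\mu_i(s)$, which also equals $\sum_{i=1}^d\int_0^t\vartheta_i(s)\,dA_i(s)-\sum_{i=1}^d\int_{\mathbb{R}}L^{X_i}_t(x)\,df_i'(x)$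 and is of bounded variation. Multiplicative generation: $\eta_i(t):=\vartheta_i(t)\exp\big(\int_0^t\frac{d\Gamma^G(s)}{G(\mu(s),A(s))}\big)$ (Lebesgue–Stieltjes integral in the exponent) and $\psi_i(t):=\eta_i(t)-Q^\eta(t)-C(0)$, where $Q^\eta(t)=\sum_{i=1}^d\{\eta_i(t)\mu_i(t)-\eta_i(0)\mu_i(0)\}-\sum_{i=1}^d\int_0^t\eta_i(s)\,d\mu_i(s)$ and $C(0)=\sum_{i=1}^d\vartheta_i(0)\mu_i(0)-G(\mu(0),A(0))$.
   Formalization: Assumes in addition that G(μ(0),A(0))>0 (without it f_i=−1 gives V<0) and that the limits defining ∫ϑ_i dA_i exist (they can fail for A in CBV when f_i' jumps, leaving Γ and ψ undefined). *)

theory Defs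
  imports "HOL-Analysis.Analysis"
begin

section \<open>Partitions and sums along them\<close>

definition steps :: "real set \<Rightarrow> (real \<times> real) set" where
  "steps D = {(u, v). u \<in> D \<and> v \<in> D \<and> u < v \<and> D \<inter> {u<..<v} = {}}"

definition mesh :: "real set \<Rightarrow> real" where
  "mesh D = Max ((\<lambda>(u, v). v - u) ` steps D)"

definition refining_partitions :: "real \<Rightarrow> (nat \<Rightarrow> real set) \<Rightarrow> bool" where
  "refining_partitions T P \<longleftrightarrow>
     (\<forall>n. finite (P n) \<and> {0, T} \<subseteq> P n \<and> P n \<subseteq> {0..T} \<and> P n \<subseteq> P (Suc n)) \<and>
     (\<lambda>n. mesh (P n)) \<longlonglongrightarrow> 0"

text \<open>
  Sum of \<open>g t\<^sub>j t\<^sub>j\<^sub>+\<^sub>1\<close> over the steps with \<open>t\<^sub>j \<le> t\<close>. The \<open>min\<close> replaces the right end point of the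
  last of these steps by \<open>t\<close> and leaves the others unchanged.
\<close>

definition partition_sum :: "real set \<Rightarrow> real \<Rightarrow> (real \<Rightarrow> real \<Rightarrow> real) \<Rightarrow> real" where
  "partition_sum D t g = (\<Sum>(u, v) \<in> {(u, v) \<in> steps D. u \<le> t}. g u (min v t))"

definition riemann_sum :: "real set \<Rightarrow> (real \<Rightarrow> real) \<Rightarrow> (real \<Rightarrow> real) \<Rightarrow> real \<Rightarrow> real" where
  "riemann_sum D h Y t = partition_sum D t (\<lambda>u v. h u * (Y v - Y u))"

definition pathwise_integral ::
    "(nat \<Rightarrow> real set) \<Rightarrow> (real \<Rightarrow> real) \<Rightarrow> (real \<Rightarrow> real) \<Rightarrow> real \<Rightarrow> real" where
  "pathwise_integral P h Y t = lim (\<lambda>n. riemann_sum (P n) h Y t)"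

text \<open>
  The limit of the sum over all coordinates; the limits of the individual coordinates
  are not required to exist.
\<close>

definition pathwise_integral_vec ::
    "(nat \<Rightarrow> real set) \<Rightarrow> (real \<Rightarrow> real ^ 'd) \<Rightarrow> (real \<Rightarrow> real ^ 'd) \<Rightarrow> real \<Rightarrow> real" where
  "pathwise_integral_vec P h Y t =
     lim (\<lambda>n. \<Sum>i\<in>UNIV. riemann_sum (P n) (\<lambda>s. h s $ i) (\<lambda>s. Y s $ i) t)"


section \<open>Quadratic variation and local time\<close>

definition has_quadratic_variation :: "(nat \<Rightarrow> real set) \<Rightarrow> real \<Rightarrow> (real \<Rightarrow> real) \<Rightarrow> bool" where
  "has_quadratic_variation P T Y \<longleftrightarrow>
     (\<exists>q. continuous_on {0..T} q \<and>
        (\<forall>t\<in>{0..T}. (\<lambda>n. partition_sum (P n) t (\<lambda>u v. \<bar>Y v - Y u\<bar>\<^sup>2)) \<longlonglongrightarrow> q t))"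

definition discrete_local_time :: "real set \<Rightarrow> (real \<Rightarrow> real) \<Rightarrow> real \<Rightarrow> real \<Rightarrow> real" where
  "discrete_local_time D Y t x =
     partition_sum D t (\<lambda>u v. indicator {min (Y u) (Y v)<..max (Y u) (Y v)} x * \<bar>Y v - x\<bar>)"

definition has_continuous_local_time :: "(nat \<Rightarrow> real set) \<Rightarrow> real \<Rightarrow> (real \<Rightarrow> real) \<Rightarrow> bool" where
  "has_continuous_local_time P T Y \<longleftrightarrow> continuous_on {0..T} Y \<and>
     (\<exists>L. (\<forall>t\<in>{0..T}. uniform_limit UNIV (\<lambda>n. discrete_local_time (P n) Y t) (L t) sequentially \<and>
                        continuous_on UNIV (L t)) \<and>
          continuous_on ({0..T} \<times> UNIV) (\<lambda>(t, x). L t x))"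


section \<open>Bounded variation, absolute continuity, Lebesgue-Stieltjes integrals\<close>

definition variation_sums :: "(real \<Rightarrow> 'a::real_normed_vector) \<Rightarrow> real \<Rightarrow> real \<Rightarrow> real set" where
  "variation_sums F a b =
     {\<Sum>(u, v) \<in> steps D. norm (F v - F u) | D. finite D \<and> D \<subseteq> {a..b}}"

definition bounded_variation :: "(real \<Rightarrow> 'a::real_normed_vector) \<Rightarrow> real \<Rightarrow> real \<Rightarrow> bool" where
  "bounded_variation F a b \<longleftrightarrow> bdd_above (variation_sums F a b)"

definition total_variation :: "(real \<Rightarrow> 'a::real_normed_vector) \<Rightarrow> real \<Rightarrow> real \<Rightarrow> real" where
  "total_variation F a b = Sup (variation_sums F a b)"

definition CBV :: "real \<Rightarrow> (real \<Rightarrow> 'a::real_normed_vector) set" where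
  "CBV T = {F. continuous_on {0..T} F \<and> bounded_variation F 0 T}"

definition absolutely_continuous_with_density :: "(real \<Rightarrow> real) \<Rightarrow> (real \<Rightarrow> real) \<Rightarrow> bool" where
  "absolutely_continuous_with_density f f' \<longleftrightarrow>
     (\<forall>a b. a \<le> b \<longrightarrow> set_integrable lborel {a..b} f' \<and>
                      f b - f a = (LINT x:{a..b}|lborel. f' x))"

text \<open>
  The Lebesgue-Stieltjes integral over \<open>(0, t]\<close> against a right-continuous function of bounded
  variation on \<open>[0, t]\<close>, through its positive and negative variations. These are
  frozen outside \<open>[0, t]\<close>, because \<open>interval_measure\<close> expects a function on the whole line.
\<close>

definition positive_variation :: "(real \<Rightarrow> real) \<Rightarrow> real \<Rightarrow> real" where
  "positive_variation F s = (total_variation F 0 s + (F s - F 0)) / 2"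

definition negative_variation :: "(real \<Rightarrow> real) \<Rightarrow> real \<Rightarrow> real" where
  "negative_variation F s = (total_variation F 0 s - (F s - F 0)) / 2"

definition stieltjes_integral :: "(real \<Rightarrow> real) \<Rightarrow> (real \<Rightarrow> real) \<Rightarrow> real \<Rightarrow> real" where
  "stieltjes_integral g F t =
     (LINT s:{0<..t}|interval_measure (\<lambda>s. positive_variation F (max 0 (min s t))). g s) -
     (LINT s:{0<..t}|interval_measure (\<lambda>s. negative_variation F (max 0 (min s t))). g s)"

definition locally_bounded_on :: "real set \<Rightarrow> (real \<Rightarrow> real) \<Rightarrow> bool" where
  "locally_bounded_on S g \<longleftrightarrow> (\<forall>t\<in>S. \<exists>U. open U \<and> t \<in> U \<and> bounded (g ` (U \<inter> S)))"


section \<open>Multiplicative generation\<close>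

definition gamma_process ::
    "(nat \<Rightarrow> real set) \<Rightarrow> (real ^ 'd \<Rightarrow> real ^ 'd \<Rightarrow> real) \<Rightarrow> (real \<Rightarrow> real ^ 'd) \<Rightarrow>
     (real \<Rightarrow> real ^ 'd) \<Rightarrow> (real \<Rightarrow> real ^ 'd) \<Rightarrow> real \<Rightarrow> real" where
  "gamma_process P G \<theta> \<mu> A t =
     G (\<mu> 0) (A 0) - G (\<mu> t) (A t) +
     (\<Sum>i\<in>UNIV. pathwise_integral P (\<lambda>s. \<theta> s $ i) (\<lambda>s. \<mu> s $ i) t)"

definition exponential_factor ::
    "(nat \<Rightarrow> real set) \<Rightarrow> (real ^ 'd \<Rightarrow> real ^ 'd \<Rightarrow> real) \<Rightarrow> (real \<Rightarrow> real ^ 'd) \<Rightarrow>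
     (real \<Rightarrow> real ^ 'd) \<Rightarrow> (real \<Rightarrow> real ^ 'd) \<Rightarrow> real \<Rightarrow> real" where
  "exponential_factor P G \<theta> \<mu> A t =
     exp (stieltjes_integral (\<lambda>s. 1 / G (\<mu> s) (A s)) (gamma_process P G \<theta> \<mu> A) t)"

definition self_financing_defect ::
    "(nat \<Rightarrow> real set) \<Rightarrow> (real \<Rightarrow> real ^ 'd) \<Rightarrow> (real \<Rightarrow> real ^ 'd) \<Rightarrow> real \<Rightarrow> real" where
  "self_financing_defect P \<eta> \<mu> t =
     (\<Sum>i\<in>UNIV. \<eta> t $ i * \<mu> t $ i - \<eta> 0 $ i * \<mu> 0 $ i) - pathwise_integral_vec P \<eta> \<mu> t"

definition multiplicatively_generated ::
    "(nat \<Rightarrow> real set) \<Rightarrow> (real ^ 'd \<Rightarrow> real ^ 'd \<Rightarrow> real) \<Rightarrow> (real \<Rightarrow> real ^ 'd) \<Rightarrow>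
     (real \<Rightarrow> real ^ 'd) \<Rightarrow> (real \<Rightarrow> real ^ 'd) \<Rightarrow> real \<Rightarrow> real ^ 'd" where
  "multiplicatively_generated P G \<theta> \<mu> A t =
     (let \<eta> = (\<lambda>s. exponential_factor P G \<theta> \<mu> A s *\<^sub>R \<theta> s);
          C = (\<Sum>i\<in>UNIV. \<theta> 0 $ i * \<mu> 0 $ i) - G (\<mu> 0) (A 0)
      in \<chi> i. \<eta> t $ i - self_financing_defect P \<eta> \<mu> t - C)"

end

theory Submission
  imports Defs
begin

text \<open>
  Writing \<open>E\<close> for the exponential factor, \<open>\<mu>\<^sub>1 + \<dots> + \<mu>\<^sub>d = 1\<close> reduces both formulas to
  \<open>\<Sum>\<^sub>i \<integral> E \<theta>\<^sub>i d\<mu>\<^sub>i = E G - G(0)\<close>. The Riemann sums on the left are Riemann sums of \<open>E\<close> against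
  \<open>M\<^sub>n = \<Sum>\<^sub>i \<integral> \<theta>\<^sub>i d\<mu>\<^sub>i\<close> taken along the \<open>n\<close>-th partition. If \<open>M\<^sub>n\<close> converges uniformly to
  \<open>M = G - G(0) + \<Gamma>\<close>, then summation by parts allows to replace \<open>M\<^sub>n\<close> by \<open>M\<close>, and
  \<open>E dM = E dG + E d\<Gamma> = E dG + G dE = d(E G)\<close> because \<open>dE = E d\<Gamma> / G\<close>.

  Uniformity comes from monotonicity: monotone functions that converge pointwise to a continuous
  function on a compact interval converge uniformly. This applies to the sums against \<open>A\<close> after
  adding a multiple of the total variation of \<open>A\<close>. For the sums against \<open>X\<^sub>i\<close>, write \<open>f\<^sub>i'\<close> as a
  difference of nondecreasing right-continuous functions \<open>g\<close>; the second-order remainders of the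
  discrete Tanaka formula for \<open>g\<close> are integrals of the discrete local times against \<open>dg\<close>, and
  they are nonnegative, so their sums are increasing in time.
\<close>

section \<open>Sums over the steps of a finite set\<close>

lemma finite_steps [simp]: "finite D \<Longrightarrow> finite (steps D)"
  by (rule finite_subset[of _ "D \<times> D"]) (auto simp: steps_def)

lemma steps_empty [simp]: "steps {} = {}"
  by (auto simp: steps_def)

lemma steps_singleton [simp]: "steps {x} = {}"
  by (auto simp: steps_def)

lemma stepsD:
  assumes "(u, v) \<in> steps D"
  shows "u \<in> D" "v \<in> D" "u < v" "\<And>w. w \<in> D \<Longrightarrow> w \<le> u \<or> v \<le> w"
  using assms by (auto simp: steps_def disjoint_iff)

text \<open>Basis for inductions that build a finite set from left to right.\<close>

lemma steps_insert_max:
  assumes "finite A" "A \<noteq> {}" "\<forall>a\<in>A. a < b"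
  shows "steps (insert b A) = insert (Max A, b) (steps A)"
proof -
  have M: "Max A \<in> A" "\<And>a. a \<in> A \<Longrightarrow> a \<le> Max A"
    using assms by auto
  show ?thesis
  proof (rule set_eqI, clarify)
    fix u v
    show "(u, v) \<in> steps (insert b A) \<longleftrightarrow> (u, v) \<in> insert (Max A, b) (steps A)"
    proof
      assume "(u, v) \<in> steps (insert b A)"
      note s = stepsD[OF this]
      have "u \<in> A"
        using s(1,2,3) assms(3) by force
      show "(u, v) \<in> insert (Max A, b) (steps A)"
      proof (cases "v = b")
        case True
        have "Max A \<le> u \<or> b \<le> Max A"
          using s(4)[of "Max A"] M(1) True by auto
        then show ?thesis
          using M \<open>u \<in> A\<close> assms(3) True by force
      next
        case False
        then show ?thesis
          using s \<open>u \<in> A\<close> by (force simp: steps_def)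
      qed
    next
      assume "(u, v) \<in> insert (Max A, b) (steps A)"
      then show "(u, v) \<in> steps (insert b A)"
        using M assms(3) by (force simp: steps_def)
    qed
  qed
qed

lemma sum_steps_insert_max:
  assumes "finite A" "A \<noteq> {}" "\<forall>a\<in>A. a < b"
  shows "(\<Sum>(u, v)\<in>steps (insert b A). g u v) = g (Max A) b + (\<Sum>(u, v)\<in>steps A. g u v)"
proof -
  have "(Max A, b) \<notin> steps A"
    using assms(3) by (auto simp: steps_def)
  then show ?thesis
    by (simp add: steps_insert_max[OF assms] assms(1))
qed

lemma sum_steps_telescope:
  fixes \<phi> :: "real \<Rightarrow> 'a::ab_group_add"
  assumes "finite D" "D \<noteq> {}"
  shows "(\<Sum>(u, v)\<in>steps D. \<phi> v - \<phi> u) = \<phi> (Max D) - \<phi> (Min D)"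
  using assms
proof (induction D rule: finite_linorder_max_induct)
  case (insert b A)
  show ?case
  proof (cases "A = {}")
    case False
    have "Max A < b" "Min A < b"
      using insert.hyps False by (meson Max_in Min_in)+
    then have "Max (insert b A) = b" "Min (insert b A) = Min A"
      using insert.hyps False by (auto simp: Max_insert Min_insert simp del: Max_less_iff Min_less_iff)
    then show ?thesis
      using insert.IH[OF False] sum_steps_insert_max[OF insert.hyps(1) False, of b "\<lambda>u v. \<phi> v - \<phi> u"]
        insert.hyps by simp
  qed simp
qed simp

lemma steps_split:
  assumes "x \<in> D"
  shows "steps D = steps (D \<inter> {..x}) \<union> steps (D \<inter> {x..})"
    and "steps (D \<inter> {..x}) \<inter> steps (D \<inter> {x..}) = {}"
proof -
  show "steps D = steps (D \<inter> {..x}) \<union> steps (D \<inter> {x..})"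
  proof (intro set_eqI iffI; clarify)
    fix u v assume "(u, v) \<in> steps D" "(u, v) \<notin> steps (D \<inter> {x..})"
    then show "(u, v) \<in> steps (D \<inter> {..x})"
      using stepsD(4)[OF \<open>(u, v) \<in> steps D\<close> assms] by (auto simp: steps_def)
  next
    fix u v assume "(u, v) \<in> steps (D \<inter> {..x}) \<union> steps (D \<inter> {x..})"
    then show "(u, v) \<in> steps D"
      by (fastforce simp: steps_def)
  qed
  show "steps (D \<inter> {..x}) \<inter> steps (D \<inter> {x..}) = {}"
    by (auto simp: steps_def)
qed

lemma sum_steps_split:
  assumes "finite D" "x \<in> D"
  shows "(\<Sum>p\<in>steps D. g p) = (\<Sum>p\<in>steps (D \<inter> {..x}). g p) + (\<Sum>p\<in>steps (D \<inter> {x..}). g p)"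
  unfolding steps_split(1)[OF assms(2)]
  using assms(1) by (intro sum.union_disjoint steps_split(2)[OF assms(2)]) auto

section \<open>Partitions of [0,T] and Riemann sums along them\<close>

definition partition_of :: "real \<Rightarrow> real set \<Rightarrow> bool" where
  "partition_of T D \<longleftrightarrow> finite D \<and> {0, T} \<subseteq> D \<and> D \<subseteq> {0..T}"

lemma refining_partitionsD:
  assumes "refining_partitions T P"
  shows "partition_of T (P n)" "(\<lambda>n. mesh (P n)) \<longlonglongrightarrow> 0"
  using assms by (auto simp: refining_partitions_def partition_of_def)

lemma partition_ofD:
  assumes "partition_of T D"
  shows "finite D" "0 \<in> D" "T \<in> D" "\<And>u. u \<in> D \<Longrightarrow> 0 \<le> u \<and> u \<le> T" "Max D = T" "Min D = 0"
  using assms by (auto simp: partition_of_def intro!: Max_eqI Min_eqI)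

lemma step_length_le_mesh:
  assumes "finite D" "(u, v) \<in> steps D"
  shows "v - u \<le> mesh D"
  unfolding mesh_def using assms by (intro Max_ge) force+

text \<open>Clamping at \<open>t\<close> collapses every step beyond \<open>t\<close> to the pair
  \<open>(t, t)\<close>, where \<open>g\<close> vanishes. The index set no longer depends on
  \<open>t\<close>, so sums up to different times can be subtracted term by term.\<close>

lemma partition_sum_min:
  assumes "finite D" "g t t = 0"
  shows "partition_sum D t g = (\<Sum>(u, v)\<in>steps D. g (min u t) (min v t))"
proof -
  have "(\<Sum>(u, v)\<in>steps D. g (min u t) (min v t)) =
        (\<Sum>(u, v)\<in>{(u, v) \<in> steps D. u \<le> t}. g (min u t) (min v t))"
  proof (rule sum.mono_neutral_right)
    show "\<forall>i\<in>steps D - {(u, v) \<in> steps D. u \<le> t}. (case i of (u, v) \<Rightarrow> g (min u t) (min v t)) = 0"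
      using assms(2) by (auto simp: steps_def min_def)
  qed (use assms in auto)
  also have "\<dots> = partition_sum D t g"
    unfolding partition_sum_def by (intro sum.cong) auto
  finally show ?thesis ..
qed

lemma riemann_sum_min:
  assumes "finite D"
  shows "riemann_sum D h Y t = (\<Sum>(u, v)\<in>steps D. h u * (Y (min v t) - Y (min u t)))"
  unfolding riemann_sum_def using assms
  by (subst partition_sum_min) (auto intro!: sum.cong simp: min_def dest: stepsD(3))

lemma sum_steps_clamp:
  fixes \<phi> :: "real \<Rightarrow> 'a::ab_group_add"
  assumes "partition_of T D" "0 \<le> s" "s \<le> t" "t \<le> T"
  shows "(\<Sum>(u, v)\<in>steps D. \<phi> (max s (min v t)) - \<phi> (max s (min u t))) = \<phi> t - \<phi> s"
  using sum_steps_telescope[of D "\<lambda>u. \<phi> (max s (min u t))"] partition_ofD[OF assms(1)] assms(2-)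
  by (force simp: min_def max_def)

lemma sum_steps_min:
  fixes \<phi> :: "real \<Rightarrow> 'a::ab_group_add"
  assumes "partition_of T D" "0 \<le> t" "t \<le> T"
  shows "(\<Sum>(u, v)\<in>steps D. \<phi> (min v t) - \<phi> (min u t)) = \<phi> t - \<phi> 0"
  using sum_steps_telescope[of D "\<lambda>u. \<phi> (min u t)"] partition_ofD[OF assms(1)] assms(2-)
  by (force simp: min_def max_def)

lemma riemann_sum_diff:
  assumes "finite D" "s \<le> t"
  shows "riemann_sum D h Y t - riemann_sum D h Y s =
    (\<Sum>(u, v)\<in>steps D. h u * (Y (max s (min v t)) - Y (max s (min u t))))"
proof -
  \<comment> \<open>For either end point \<open>x\<close> the difference
    \<open>Y (min x t) - Y (min x s)\<close> equals \<open>Y (max s (min x t)) - Y s\<close>; the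
    two copies of \<open>Y s\<close> cancel.\<close>
  have *: "Y (min v t) - Y (min u t) - (Y (min v s) - Y (min u s)) =
      Y (max s (min v t)) - Y (max s (min u t))" for u v
    using assms(2) by (auto simp: min_def max_def)
  have "riemann_sum D h Y t - riemann_sum D h Y s =
      (\<Sum>(u, v)\<in>steps D. h u * (Y (min v t) - Y (min u t) - (Y (min v s) - Y (min u s))))"
    using assms(1)
    by (simp add: riemann_sum_min case_prod_beta algebra_simps flip: sum_subtractf)
  then show ?thesis
    by (simp only: *)
qed

text \<open>Bounded variation enters here and below through a control function \<open>W\<close>
  whose increments dominate those of \<open>Y\<close>. Such bounds telescope over the steps and
  survive passage to the limit.\<close>

lemma riemann_sum_Lipschitz:
  assumes D: "partition_of T D" and st: "0 \<le> s" "s \<le> t" "t \<le> T"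
    and h: "\<And>u. u \<in> D \<Longrightarrow> \<bar>h u\<bar> \<le> B"
    and Y: "\<And>a b. 0 \<le> a \<Longrightarrow> a \<le> b \<Longrightarrow> b \<le> T \<Longrightarrow> \<bar>Y b - Y a\<bar> \<le> W b - W a"
  shows "\<bar>riemann_sum D h Y t - riemann_sum D h Y s\<bar> \<le> B * (W t - W s)"
proof -
  note p = partition_ofD[OF D]
  have "\<bar>riemann_sum D h Y t - riemann_sum D h Y s\<bar> \<le>
      (\<Sum>p\<in>steps D. \<bar>case p of (u, v) \<Rightarrow> h u * (Y (max s (min v t)) - Y (max s (min u t)))\<bar>)"
    unfolding riemann_sum_diff[OF p(1) st(2)] by (rule sum_abs)
  also have "\<dots> \<le> (\<Sum>(u, v)\<in>steps D. B * W (max s (min v t)) - B * W (max s (min u t)))"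
  proof (rule sum_mono, clarify)
    fix u v assume uv: "(u, v) \<in> steps D"
    note s = stepsD[OF uv]
    have "\<bar>h u\<bar> * \<bar>Y (max s (min v t)) - Y (max s (min u t))\<bar> \<le>
        B * (W (max s (min v t)) - W (max s (min u t)))"
      using s(3) st p(4)[OF s(1)] p(4)[OF s(2)] h[OF s(1)]
      by (intro mult_mono Y) (auto simp: max_def min_def)
    then show "\<bar>h u * (Y (max s (min v t)) - Y (max s (min u t)))\<bar> \<le>
        B * W (max s (min v t)) - B * W (max s (min u t))"
      by (simp only: abs_mult flip: right_diff_distrib)
  qed
  also have "\<dots> = B * (W t - W s)"
    by (subst sum_steps_clamp[OF D st, of "\<lambda>x. B * W x"]) (simp add: algebra_simps)
  finally show ?thesis .
qed

lemma riemann_sum_diff_within_step: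
  assumes "finite D" "(u, v) \<in> steps D" "u \<le> s" "s \<le> t" "t \<le> v"
  shows "riemann_sum D h Y t - riemann_sum D h Y s = h u * (Y t - Y s)"
proof -
  note s = stepsD[OF assms(2)]
  have "riemann_sum D h Y t - riemann_sum D h Y s =
    (\<Sum>p\<in>steps D. if p = (u, v) then h u * (Y t - Y s) else 0)"
    unfolding riemann_sum_diff[OF assms(1,4)]
  proof (rule sum.cong[OF refl], clarify)
    fix a b assume ab: "(a, b) \<in> steps D"
    note s' = stepsD[OF ab]
    show "h a * (Y (max s (min b t)) - Y (max s (min a t))) =
        (if (a, b) = (u, v) then h u * (Y t - Y s) else 0)"
    proof (cases "(a, b) = (u, v)")
      case True
      then show ?thesis using assms(3-) s(3) by (auto simp: min_def max_def)
    next
      case False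
      \<comment> \<open>Any other step lies entirely on one side of \<open>[u, v]\<close>, so
        clamping it to \<open>[s, t]\<close> leaves a single point.\<close>
      have "b \<le> u \<or> v \<le> a"
        using s(4)[OF s'(1)] s(4)[OF s'(2)] s'(4)[OF s(1)] s'(4)[OF s(2)] s(3) s'(3) False by auto
      then have "max s (min b t) = max s (min a t) \<or> s = t"
        using assms(3-) s(3) s'(3) by (auto simp: min_def max_def)
      then show ?thesis
        using False assms(4) by (auto simp: min_def max_def)
    qed
  qed
  also have "\<dots> = h u * (Y t - Y s)"
    using assms(1,2) by (simp add: sum.delta)
  finally show ?thesis .
qed

text \<open>Associativity of the integral, exact at the discrete level because the inner and the
  outer sums use the same partition: during a step that starts at \<open>u\<close> the inner sum
  grows by \<open>h i u\<close> times the increment of \<open>Y i\<close>. The vector-valued sums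
  thereby become sums of one scalar integrand against one scalar integrator.\<close>

lemma riemann_sum_compose:
  assumes "finite D"
  shows "(\<Sum>i\<in>I. riemann_sum D (\<lambda>s. E s * h i s) (Y i) t) =
    riemann_sum D E (\<lambda>s. \<Sum>i\<in>I. riemann_sum D (h i) (Y i) s) t"
proof -
  have "(\<Sum>i\<in>I. riemann_sum D (\<lambda>s. E s * h i s) (Y i) t) =
     (\<Sum>(u, v)\<in>steps D. \<Sum>i\<in>I. E u * h i u * (Y i (min v t) - Y i (min u t)))"
    using assms by (simp add: riemann_sum_min case_prod_beta sum.swap[of _ I])
  also have "\<dots> = (\<Sum>(u, v)\<in>steps D. E u * ((\<Sum>i\<in>I. riemann_sum D (h i) (Y i) (min v t)) -
      (\<Sum>i\<in>I. riemann_sum D (h i) (Y i) (min u t))))"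
  proof (rule sum.cong[OF refl], clarify)
    fix u v assume uv: "(u, v) \<in> steps D"
    have "riemann_sum D (h i) (Y i) (min v t) - riemann_sum D (h i) (Y i) (min u t) =
        h i u * (Y i (min v t) - Y i (min u t))" for i
    proof (cases "u \<le> t")
      case True
      then show ?thesis
        using stepsD[OF uv] by (intro riemann_sum_diff_within_step[OF assms uv]) auto
    next
      case False
      then show ?thesis using stepsD(3)[OF uv] by (simp add: min_def)
    qed
    then show "(\<Sum>i\<in>I. E u * h i u * (Y i (min v t) - Y i (min u t))) =
      E u * ((\<Sum>i\<in>I. riemann_sum D (h i) (Y i) (min v t)) -
      (\<Sum>i\<in>I. riemann_sum D (h i) (Y i) (min u t)))"
      by (simp add: sum_distrib_left mult.assoc flip: sum_subtractf)
  qed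
  also have "\<dots> = riemann_sum D E (\<lambda>s. \<Sum>i\<in>I. riemann_sum D (h i) (Y i) s) t"
    using assms by (simp add: riemann_sum_min)
  finally show ?thesis .
qed

text \<open>Summation by parts moves the increments from \<open>Y\<close> to \<open>E\<close>.\<close>

lemma riemann_sum_small_integrator:
  assumes D: "partition_of T D" and t: "0 \<le> t" "t \<le> T"
    and Y: "\<And>s. 0 \<le> s \<Longrightarrow> s \<le> T \<Longrightarrow> \<bar>Y s\<bar> \<le> \<epsilon>"
    and E: "\<And>s. 0 \<le> s \<Longrightarrow> s \<le> T \<Longrightarrow> \<bar>E s\<bar> \<le> B"
    and W: "\<And>a b. 0 \<le> a \<Longrightarrow> a \<le> b \<Longrightarrow> b \<le> T \<Longrightarrow> \<bar>E b - E a\<bar> \<le> W b - W a"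
  shows "\<bar>riemann_sum D E Y t\<bar> \<le> \<epsilon> * (2 * B + (W t - W 0))"
proof -
  note p = partition_ofD[OF D]
  let ?c = "\<lambda>u v. Y (min v t) * (E (min v t) - E (min u t))"
  have eps: "0 \<le> \<epsilon>"
    using Y[of t] t by linarith
  \<comment> \<open>Discrete product rule: with \<open>E\<close> taken at the left and
    \<open>Y\<close> at the right end point there is no second-order term.\<close>
  have "riemann_sum D E Y t = (\<Sum>(u, v)\<in>steps D. (E (min v t) * Y (min v t) - E (min u t) * Y (min u t)) - ?c u v)"
    unfolding riemann_sum_min[OF p(1)]
    by (rule sum.cong[OF refl]) (auto simp: min_def algebra_simps dest: stepsD)
  also have "\<dots> = E t * Y t - E 0 * Y 0 - (\<Sum>(u, v)\<in>steps D. ?c u v)"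
    using sum_steps_min[OF D t, of "\<lambda>x. E x * Y x"] by (simp add: sum_subtractf case_prod_beta)
  finally have 1: "riemann_sum D E Y t = E t * Y t - E 0 * Y 0 - (\<Sum>(u, v)\<in>steps D. ?c u v)" .
  have "\<bar>\<Sum>(u, v)\<in>steps D. ?c u v\<bar> \<le> (\<Sum>p\<in>steps D. \<bar>case p of (u, v) \<Rightarrow> ?c u v\<bar>)"
    by (rule sum_abs)
  also have "\<dots> \<le> (\<Sum>(u, v)\<in>steps D. \<epsilon> * W (min v t) - \<epsilon> * W (min u t))"
  proof (rule sum_mono, clarify)
    fix u v assume uv: "(u, v) \<in> steps D"
    note s = stepsD[OF uv]
    have "\<bar>Y (min v t)\<bar> * \<bar>E (min v t) - E (min u t)\<bar> \<le> \<epsilon> * (W (min v t) - W (min u t))"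
      using s(3) t eps p(4)[OF s(1)] p(4)[OF s(2)]
      by (intro mult_mono Y W) auto
    then show "\<bar>?c u v\<bar> \<le> \<epsilon> * W (min v t) - \<epsilon> * W (min u t)"
      by (simp only: abs_mult flip: right_diff_distrib)
  qed
  also have "\<dots> = \<epsilon> * (W t - W 0)"
    by (subst sum_steps_min[OF D t, of "\<lambda>x. \<epsilon> * W x"]) (simp add: algebra_simps)
  finally have 2: "\<bar>\<Sum>(u, v)\<in>steps D. ?c u v\<bar> \<le> \<epsilon> * (W t - W 0)" .
  \<comment> \<open>The boundary terms at \<open>0\<close> and \<open>t\<close> produce the summand
    \<open>2 * B\<close>.\<close>
  have 3: "\<bar>E s * Y s\<bar> \<le> B * \<epsilon>" if "0 \<le> s" "s \<le> T" for s
    unfolding abs_mult using that E[OF that] by (intro mult_mono E Y) auto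
  have "\<bar>riemann_sum D E Y t\<bar> \<le> B * \<epsilon> + B * \<epsilon> + \<epsilon> * (W t - W 0)"
    using 1 2 3[OF t] 3[of 0] t by linarith
  then show ?thesis by (simp add: algebra_simps)
qed

text \<open>Local errors that are small relative to the increments of \<open>W\<close>, uniformly
  over short intervals, add up to a small multiple of \<open>W t - W 0\<close>, while the increments
  of \<open>F\<close> telescope. An integral can thus be identified from its behaviour on short
  intervals.\<close>

lemma riemann_sum_tendsto_by_increments:
  assumes P: "refining_partitions T P" and t: "0 \<le> t" "t \<le> T"
    and W: "\<And>a b. 0 \<le> a \<Longrightarrow> a \<le> b \<Longrightarrow> b \<le> T \<Longrightarrow> W a \<le> W b"
    and increments: "\<And>\<epsilon>. \<epsilon> > 0 \<Longrightarrow> \<exists>\<delta>>0. \<forall>u v. 0 \<le> u \<longrightarrow> u \<le> v \<longrightarrow> v \<le> T \<longrightarrow> v - u < \<delta> \<longrightarrow>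
       \<bar>h u * (Y v - Y u) - (F v - F u)\<bar> \<le> \<epsilon> * (W v - W u)"
  shows "(\<lambda>n. riemann_sum (P n) h Y t) \<longlonglongrightarrow> F t - F 0"
proof (rule LIMSEQ_I)
  fix r :: real assume r: "r > 0"
  \<comment> \<open>The added 1 covers the case \<open>W t = W 0\<close> and makes the final
    estimate strict.\<close>
  define \<epsilon> where "\<epsilon> = r / (W t - W 0 + 1)"
  have W0: "W 0 \<le> W t" using W t by auto
  have eps: "\<epsilon> > 0" "\<epsilon> * (W t - W 0) < r"
    using r W0 by (auto simp: \<epsilon>_def field_simps)
  obtain \<delta> where \<delta>: "\<delta> > 0" "\<And>u v. 0 \<le> u \<Longrightarrow> u \<le> v \<Longrightarrow> v \<le> T \<Longrightarrow> v - u < \<delta> \<Longrightarrow>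
       \<bar>h u * (Y v - Y u) - (F v - F u)\<bar> \<le> \<epsilon> * (W v - W u)"
    using increments[OF eps(1)] by blast
  obtain N where N: "\<And>n. n \<ge> N \<Longrightarrow> mesh (P n) < \<delta>"
    using order_tendstoD(2)[OF refining_partitionsD(2)[OF P] \<delta>(1)]
    by (auto simp: eventually_sequentially)
  have "\<bar>riemann_sum (P n) h Y t - (F t - F 0)\<bar> < r" if n: "n \<ge> N" for n
  proof -
    note D = refining_partitionsD(1)[OF P, of n]
    note p = partition_ofD[OF D]
    have "riemann_sum (P n) h Y t - (F t - F 0) =
       (\<Sum>(u, v)\<in>steps (P n). h u * (Y (min v t) - Y (min u t)) - (F (min v t) - F (min u t)))"
      using p(1) sum_steps_min[OF D t, of F] by (simp add: riemann_sum_min case_prod_beta sum_subtractf)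
    then have "\<bar>riemann_sum (P n) h Y t - (F t - F 0)\<bar> \<le> (\<Sum>q\<in>steps (P n). \<bar>case q of (u, v) \<Rightarrow>
        h u * (Y (min v t) - Y (min u t)) - (F (min v t) - F (min u t))\<bar>)"
      by (simp only: sum_abs)
    also have "\<dots> \<le> (\<Sum>(u, v)\<in>steps (P n). \<epsilon> * W (min v t) - \<epsilon> * W (min u t))"
    proof (rule sum_mono, clarify)
      fix u v assume uv: "(u, v) \<in> steps (P n)"
      note s = stepsD[OF uv]
      have "v - u < \<delta>" using step_length_le_mesh[OF p(1) uv] N[OF n] by linarith
      then show "\<bar>h u * (Y (min v t) - Y (min u t)) - (F (min v t) - F (min u t))\<bar> \<le>
          \<epsilon> * W (min v t) - \<epsilon> * W (min u t)"
        using \<delta>(2)[of u "min v t"] s(3) t p(4)[OF s(1)] p(4)[OF s(2)]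
        by (cases "u \<le> t") (auto simp: algebra_simps min_def split: if_splits)
    qed
    also have "\<dots> = \<epsilon> * (W t - W 0)"
      by (subst sum_steps_min[OF D t, of "\<lambda>x. \<epsilon> * W x"]) (simp add: algebra_simps)
    also have "\<dots> < r" by (rule eps)
    finally show ?thesis .
  qed
  then show "\<exists>no. \<forall>n\<ge>no. norm (riemann_sum (P n) h Y t - (F t - F 0)) < r"
    by (auto intro!: exI[of _ N])
qed

section \<open>Total variation\<close>

text \<open>The finer steps are grouped by the coarse step that contains them, and the triangle
  inequality is applied to the telescoping sum in each group. Finer steps beyond the extreme points
  of \<open>D\<close> belong to no group and only add nonnegative terms.\<close>

lemma sum_steps_norm_mono:
  fixes F :: "real \<Rightarrow> 'a::real_normed_vector"
  assumes "finite D'" "D \<subseteq> D'"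
  shows "(\<Sum>(u, v)\<in>steps D. norm (F v - F u)) \<le> (\<Sum>(u, v)\<in>steps D'. norm (F v - F u))"
proof -
  have fin: "finite D"
    using assms finite_subset by blast
  let ?S = "\<lambda>p. steps (D' \<inter> {fst p..snd p})"
  have "(\<Sum>(u, v)\<in>steps D. norm (F v - F u)) \<le> (\<Sum>p\<in>steps D. \<Sum>(u, v)\<in>?S p. norm (F v - F u))"
  proof (rule sum_mono, clarify)
    fix u v assume uv: "(u, v) \<in> steps D"
    note s = stepsD[OF uv]
    have uv': "u \<in> D'" "v \<in> D'" using s assms(2) by auto
    have "Max (D' \<inter> {u..v}) = v" "Min (D' \<inter> {u..v}) = u"
      using assms(1) s uv' by (auto intro!: Max_eqI Min_eqI)
    then have "F v - F u = (\<Sum>(a, b)\<in>steps (D' \<inter> {u..v}). F b - F a)"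
      using assms(1) s uv' by (subst sum_steps_telescope) auto
    also have "norm \<dots> \<le> (\<Sum>q\<in>steps (D' \<inter> {u..v}). norm (case q of (a, b) \<Rightarrow> F b - F a))"
      by (rule norm_sum)
    finally show "norm (F v - F u) \<le> (\<Sum>(a, b)\<in>?S (u, v). norm (F b - F a))"
      by (simp add: case_prod_beta)
  qed
  also have "\<dots> = (\<Sum>(u, v)\<in>(\<Union>p\<in>steps D. ?S p). norm (F v - F u))"
  proof (rule sum.UNION_disjoint[symmetric])
    \<comment> \<open>Distinct coarse steps share at most an end point, and a fine step has positive
      length.\<close>
    show "\<forall>p\<in>steps D. \<forall>q\<in>steps D. p \<noteq> q \<longrightarrow> ?S p \<inter> ?S q = {}"
    proof (intro ballI impI, rule ccontr)
      fix p q assume pq: "p \<in> steps D" "q \<in> steps D" "p \<noteq> q" "?S p \<inter> ?S q \<noteq> {}"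
      obtain u v a b where [simp]: "p = (u, v)" "q = (a, b)"
        by (metis surj_pair)
      note s = stepsD[OF pq(1)[simplified]] and s' = stepsD[OF pq(2)[simplified]]
      have "v \<le> a \<or> b \<le> u"
        using s(4)[OF s'(1)] s(4)[OF s'(2)] s'(4)[OF s(1)] s'(4)[OF s(2)] s(3) s'(3) pq(3) by auto
      then show False using pq(4) by (auto simp: steps_def)
    qed
  qed (use assms fin in auto)
  also have "\<dots> \<le> (\<Sum>(u, v)\<in>steps D'. norm (F v - F u))"
  proof (rule sum_mono2)
    show "(\<Union>p\<in>steps D. ?S p) \<subseteq> steps D'"
    proof clarify
      fix u v a b assume "(u, v) \<in> steps D" "(a, b) \<in> steps (D' \<inter> {fst (u, v)..snd (u, v)})"
      then show "(a, b) \<in> steps D'"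
        by (fastforce simp: steps_def)
    qed
  qed (use assms in auto)
  finally show ?thesis .
qed

lemma variation_sums_mono:
  "a \<le> c \<Longrightarrow> d \<le> b \<Longrightarrow> variation_sums F c d \<subseteq> variation_sums F a b"
  unfolding variation_sums_def by fastforce

lemma variation_sumsI:
  "finite D \<Longrightarrow> D \<subseteq> {a..b} \<Longrightarrow> (\<Sum>(u, v)\<in>steps D. norm (F v - F u)) \<in> variation_sums F a b"
  unfolding variation_sums_def by blast

lemma zero_in_variation_sums: "0 \<in> variation_sums F a b"
  using variation_sumsI[of "{}" a b F] by simp

lemma bounded_variation_subinterval:
  "bounded_variation F a b \<Longrightarrow> a \<le> c \<Longrightarrow> d \<le> b \<Longrightarrow> bounded_variation F c d"
  unfolding bounded_variation_def using bdd_above_mono variation_sums_mono by metis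

lemma variation_sum_le_total_variation:
  assumes "bounded_variation F a b" "finite D" "D \<subseteq> {a..b}"
  shows "(\<Sum>(u, v)\<in>steps D. norm (F v - F u)) \<le> total_variation F a b"
  using assms unfolding total_variation_def bounded_variation_def
  by (intro cSup_upper variation_sumsI)

lemma total_variation_leI:
  assumes "\<And>D. finite D \<Longrightarrow> D \<subseteq> {a..b} \<Longrightarrow> (\<Sum>(u, v)\<in>steps D. norm (F v - F u)) \<le> c"
  shows "total_variation F a b \<le> c"
  unfolding total_variation_def
proof (rule cSup_least)
  show "variation_sums F a b \<noteq> {}" using zero_in_variation_sums by blast
qed (use assms in \<open>auto simp: variation_sums_def\<close>)

lemma norm_diff_le_total_variation:
  assumes "bounded_variation F a b" "a \<le> b"
  shows "norm (F b - F a) \<le> total_variation F a b"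
proof (cases "a = b")
  case True
  then show ?thesis
    using variation_sum_le_total_variation[OF assms(1), of "{}"] by simp
next
  case False
  have "steps {a, b} = {(a, b)}"
    using False assms(2) by (auto simp: steps_def)
  then show ?thesis
    using variation_sum_le_total_variation[OF assms(1), of "{a, b}"] assms(2) by simp
qed

text \<open>Inserting \<open>x\<close> into a finite set does not decrease its sum and lets it be
  split at \<open>x\<close>; conversely, sums from the two sides of \<open>x\<close> can be glued
  together.\<close>

lemma total_variation_add:
  assumes bv: "bounded_variation F a b" and x: "a \<le> x" "x \<le> b"
  shows "total_variation F a b = total_variation F a x + total_variation F x b"
proof (rule antisym)
  have bv': "bounded_variation F a x" "bounded_variation F x b"
    using bounded_variation_subinterval[OF bv] x by auto
  show "total_variation F a b \<le> total_variation F a x + total_variation F x b"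
  proof (rule total_variation_leI)
    fix D assume D: "finite D" "D \<subseteq> {a..b}"
    have "(\<Sum>(u, v)\<in>steps D. norm (F v - F u)) \<le> (\<Sum>(u, v)\<in>steps (insert x D). norm (F v - F u))"
      using D by (intro sum_steps_norm_mono) auto
    also have "\<dots> = (\<Sum>(u, v)\<in>steps (insert x D \<inter> {..x}). norm (F v - F u)) +
        (\<Sum>(u, v)\<in>steps (insert x D \<inter> {x..}). norm (F v - F u))"
      using D by (intro sum_steps_split) auto
    also have "\<dots> \<le> total_variation F a x + total_variation F x b"
      using D x by (intro add_mono variation_sum_le_total_variation bv') auto
    finally show "(\<Sum>(u, v)\<in>steps D. norm (F v - F u)) \<le> total_variation F a x + total_variation F x b" .
  qed
  have *: "(\<Sum>(u, v)\<in>steps D1. norm (F v - F u)) + (\<Sum>(u, v)\<in>steps D2. norm (F v - F u)) \<le> total_variation F a b"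
    if D: "finite D1" "D1 \<subseteq> {a..x}" "finite D2" "D2 \<subseteq> {x..b}" for D1 D2
  proof -
    let ?D = "insert x (D1 \<union> D2)"
    have "(\<Sum>(u, v)\<in>steps D1. norm (F v - F u)) + (\<Sum>(u, v)\<in>steps D2. norm (F v - F u)) \<le>
      (\<Sum>(u, v)\<in>steps (?D \<inter> {..x}). norm (F v - F u)) + (\<Sum>(u, v)\<in>steps (?D \<inter> {x..}). norm (F v - F u))"
      using D by (intro add_mono sum_steps_norm_mono) auto
    also have "\<dots> = (\<Sum>(u, v)\<in>steps ?D. norm (F v - F u))"
      using D by (intro sum_steps_split[symmetric]) auto
    also have "\<dots> \<le> total_variation F a b"
      using D x by (intro variation_sum_le_total_variation bv) auto
    finally show ?thesis .
  qed
  \<comment> \<open>The two suprema are taken one after the other, each time with the other sum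
    moved to the right-hand side.\<close>
  have "total_variation F x b \<le> total_variation F a b - (\<Sum>(u, v)\<in>steps D. norm (F v - F u))"
    if "finite D" "D \<subseteq> {a..x}" for D
  proof (rule total_variation_leI)
    fix D' assume "finite D'" "D' \<subseteq> {x..b}"
    then show "(\<Sum>(u, v)\<in>steps D'. norm (F v - F u)) \<le> total_variation F a b - (\<Sum>(u, v)\<in>steps D. norm (F v - F u))"
      using *[OF that, of D'] by linarith
  qed
  then have "total_variation F a x \<le> total_variation F a b - total_variation F x b"
    by (intro total_variation_leI) (simp add: le_diff_eq add.commute)
  then show "total_variation F a x + total_variation F x b \<le> total_variation F a b"
    by simp
qed

lemma total_variation_increment:
  assumes "bounded_variation F a b" "a \<le> x" "x \<le> y" "y \<le> b"
  shows "norm (F y - F x) \<le> total_variation F a y - total_variation F a x"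
    and "total_variation F a y - total_variation F a x = total_variation F x y"
proof -
  show 1: "total_variation F a y - total_variation F a x = total_variation F x y"
    using total_variation_add[of F a y x] assms bounded_variation_subinterval[OF assms(1), of a y] by simp
  show "norm (F y - F x) \<le> total_variation F a y - total_variation F a x"
    unfolding 1 using assms
    by (intro norm_diff_le_total_variation bounded_variation_subinterval[OF assms(1)]) auto
qed

text \<open>
  Since \<open>F\<close> need not be continuous here, the estimate yields one-sided continuity as well.
\<close>

lemma total_variation_near:
  assumes bv: "bounded_variation F a b" and x: "a \<le> x" "x \<le> b" and \<epsilon>: "0 < \<epsilon>"
  shows "\<exists>\<delta>>0. \<forall>y. a \<le> y \<longrightarrow> y \<le> b \<longrightarrow> \<bar>y - x\<bar> < \<delta> \<longrightarrow>
    \<bar>total_variation F a y - total_variation F a x\<bar> \<le> norm (F y - F x) + \<epsilon>"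
proof -
  have "\<exists>s\<in>variation_sums F a b. Sup (variation_sums F a b) - \<epsilon> < s"
    using zero_in_variation_sums[of F a b] bv \<epsilon> unfolding bounded_variation_def
    by (intro less_cSupD) auto
  then obtain D0 where D0: "finite D0" "D0 \<subseteq> {a..b}"
    "total_variation F a b - \<epsilon> < (\<Sum>(u, v)\<in>steps D0. norm (F v - F u))"
    unfolding variation_sums_def total_variation_def by auto
  define D where "D = insert x D0"
  have D: "finite D" "D \<subseteq> {a..b}" "x \<in> D"
    using D0 x by (auto simp: D_def)
  \<comment> \<open>No point of \<open>D\<close> lies strictly between \<open>x\<close> and a point
    \<open>y\<close> closer to it than \<open>\<delta>\<close>.\<close>
  obtain \<delta> where \<delta>: "\<delta> > 0" "\<And>z. z \<in> D \<Longrightarrow> z \<noteq> x \<Longrightarrow> \<delta> \<le> \<bar>z - x\<bar>"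
    using finite_set_avoid[OF D(1), of x] by (auto simp: dist_real_def abs_minus_commute)
  \<comment> \<open>\<open>D0\<close> misses the total variation by less than
    \<open>\<epsilon>\<close>. Once refined by \<open>lo\<close> and \<open>hi\<close> it has a
    single step between them, so replacing the contributions on both sides by the full variations
    there leaves at most \<open>\<epsilon>\<close> of excess variation on \<open>[lo, hi]\<close>.
    The names \<open>lo\<close> and \<open>hi\<close> treat both orders of \<open>x\<close> and
    \<open>y\<close> at once.\<close>
  have main: "total_variation F lo hi \<le> norm (F hi - F lo) + \<epsilon>"
    if "lo < hi" "a \<le> lo" "hi \<le> b" "{lo, hi} = {x, y}" "\<bar>y - x\<bar> < \<delta>" for lo hi y
  proof -
    let ?D = "insert lo (insert hi D)"
    have gap: "z \<le> lo \<or> hi \<le> z" if "z \<in> D" for z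
      using \<delta>(2)[OF that] \<open>{lo, hi} = {x, y}\<close> \<open>lo < hi\<close> \<open>\<bar>y - x\<bar> < \<delta>\<close>
      by (cases "z = x") (auto simp: doubleton_eq_iff)
    have mid: "?D \<inter> {lo..} \<inter> {..hi} = {lo, hi}"
      using \<open>lo < hi\<close> by (auto dest: gap intro: antisym)
    have st: "steps {lo, hi} = {(lo, hi)}"
      using \<open>lo < hi\<close> by (auto simp: steps_def)
    have "total_variation F a b - \<epsilon> < (\<Sum>(u, v)\<in>steps D0. norm (F v - F u))"
      by (rule D0)
    also have "\<dots> \<le> (\<Sum>(u, v)\<in>steps ?D. norm (F v - F u))"
      using D by (intro sum_steps_norm_mono) (auto simp: D_def)
    also have "\<dots> = (\<Sum>(u, v)\<in>steps (?D \<inter> {..lo}). norm (F v - F u)) +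
        (\<Sum>(u, v)\<in>steps (?D \<inter> {lo..}). norm (F v - F u))"
      using D by (intro sum_steps_split) auto
    also have "(\<Sum>(u, v)\<in>steps (?D \<inter> {lo..}). norm (F v - F u)) =
        (\<Sum>(u, v)\<in>steps (?D \<inter> {lo..} \<inter> {..hi}). norm (F v - F u)) +
        (\<Sum>(u, v)\<in>steps (?D \<inter> {lo..} \<inter> {hi..}). norm (F v - F u))"
      using D \<open>lo < hi\<close> by (intro sum_steps_split) auto
    also have "(\<Sum>(u, v)\<in>steps (?D \<inter> {lo..} \<inter> {..hi}). norm (F v - F u)) = norm (F hi - F lo)"
      unfolding mid st by simp
    finally have "total_variation F a b - \<epsilon> < (\<Sum>(u, v)\<in>steps (?D \<inter> {..lo}). norm (F v - F u)) +
        (norm (F hi - F lo) + (\<Sum>(u, v)\<in>steps (?D \<inter> {lo..} \<inter> {hi..}). norm (F v - F u)))" .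
    moreover have "(\<Sum>(u, v)\<in>steps (?D \<inter> {..lo}). norm (F v - F u)) \<le> total_variation F a lo"
      using D that by (intro variation_sum_le_total_variation bounded_variation_subinterval[OF bv]) auto
    moreover have "(\<Sum>(u, v)\<in>steps (?D \<inter> {lo..} \<inter> {hi..}). norm (F v - F u)) \<le> total_variation F hi b"
      using D that by (intro variation_sum_le_total_variation bounded_variation_subinterval[OF bv]) auto
    moreover have "total_variation F a b = total_variation F a lo + total_variation F lo b"
      using that by (intro total_variation_add[OF bv]) auto
    moreover have "total_variation F lo b = total_variation F lo hi + total_variation F hi b"
      using that by (intro total_variation_add bounded_variation_subinterval[OF bv]) auto
    ultimately show ?thesis by linarith
  qed
  show ?thesis
  proof (intro exI[of _ \<delta>] conjI allI impI \<delta>(1))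
    fix y assume y: "a \<le> y" "y \<le> b" "\<bar>y - x\<bar> < \<delta>"
    consider "y < x" | "y = x" | "x < y" by linarith
    then show "\<bar>total_variation F a y - total_variation F a x\<bar> \<le> norm (F y - F x) + \<epsilon>"
    proof cases
      case 1
      have "total_variation F y x \<le> norm (F y - F x) + \<epsilon>"
        using main[of y x y] y x 1 by (auto simp: insert_commute norm_minus_commute)
      moreover have "total_variation F a x - total_variation F a y = total_variation F y x"
        "norm (F x - F y) \<le> total_variation F a x - total_variation F a y"
        using total_variation_increment[OF bv, of y x] y x 1 by auto
      ultimately show ?thesis
        using norm_ge_zero[of "F x - F y"] by linarith
    next
      case 3
      have "total_variation F x y \<le> norm (F y - F x) + \<epsilon>"
        using main[of x y y] y x 3 by auto
      moreover have "total_variation F a y - total_variation F a x = total_variation F x y"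
        "norm (F y - F x) \<le> total_variation F a y - total_variation F a x"
        using total_variation_increment[OF bv, of x y] y x 3 by auto
      ultimately show ?thesis
        using norm_ge_zero[of "F y - F x"] by linarith
    qed (use \<epsilon> in simp)
  qed
qed

text \<open>The set \<open>S\<close> selects the kind of continuity: \<open>{0..T}\<close> for the
  continuous integrators in time, \<open>{x..r}\<close> for the density \<open>f'\<close>, which is
  only right-continuous.\<close>

lemma continuous_total_variation:
  assumes bv: "bounded_variation F a b" and x: "a \<le> x" "x \<le> b" and S: "S \<subseteq> {a..b}"
    and F: "continuous (at x within S) F"
  shows "continuous (at x within S) (total_variation F a)"
  unfolding continuous_within_eps_delta
proof (intro allI impI)
  fix e :: real assume e: "e > 0"
  obtain d1 where d1: "d1 > 0" "\<And>y. y \<in> S \<Longrightarrow> dist y x < d1 \<Longrightarrow> dist (F y) (F x) < e / 2"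
    using F[unfolded continuous_within_eps_delta, rule_format, of "e/2"] e by auto
  obtain d2 where d2: "d2 > 0" "\<And>y. a \<le> y \<Longrightarrow> y \<le> b \<Longrightarrow> \<bar>y - x\<bar> < d2 \<Longrightarrow>
    \<bar>total_variation F a y - total_variation F a x\<bar> \<le> norm (F y - F x) + e / 3"
    using total_variation_near[OF bv x, of "e/3"] e by auto
  show "\<exists>d>0. \<forall>y\<in>S. dist y x < d \<longrightarrow> dist (total_variation F a y) (total_variation F a x) < e"
  proof (intro exI[of _ "min d1 d2"] conjI ballI impI)
    fix y assume y: "y \<in> S" "dist y x < min d1 d2"
    have "dist (F y) (F x) < e / 2" using d1(2)[of y] y by simp
    moreover have "\<bar>total_variation F a y - total_variation F a x\<bar> \<le> norm (F y - F x) + e / 3"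
      using d2(2)[of y] y S by (auto simp: dist_real_def)
    ultimately show "dist (total_variation F a y) (total_variation F a x) < e"
      using e unfolding dist_norm real_norm_def by linarith
  qed (use d1 d2 in simp)
qed

lemma bounded_variation_dominated:
  assumes ab: "a \<le> b"
    and W: "\<And>x y. a \<le> x \<Longrightarrow> x \<le> y \<Longrightarrow> y \<le> b \<Longrightarrow> norm (F y - F x) \<le> W y - W x"
  shows "bounded_variation F a b"
proof -
  have *: "(\<Sum>(u, v)\<in>steps D. norm (F v - F u)) \<le> W b - W a" if D: "finite D" "D \<subseteq> {a..b}" for D
  proof (cases "D = {}")
    case False
    have in_D: "Max D \<in> D" "Min D \<in> D" using D False by auto
    have mono: "W x \<le> W y" if "a \<le> x" "x \<le> y" "y \<le> b" for x y
      using W[OF that] norm_ge_zero[of "F y - F x"] by linarith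
    have "(\<Sum>(u, v)\<in>steps D. norm (F v - F u)) \<le> (\<Sum>(u, v)\<in>steps D. W v - W u)"
      using D by (intro sum_mono) (auto intro!: W dest: stepsD)
    also have "\<dots> = W (Max D) - W (Min D)"
      by (rule sum_steps_telescope) (use D False in auto)
    also have "\<dots> \<le> W b - W a"
      using D in_D ab by (intro diff_mono mono) auto
    finally show ?thesis .
  next
    case True
    have "0 \<le> W b - W a"
      using W[of a b] ab by (intro order.trans[OF norm_ge_zero]) auto
    then show ?thesis using True by simp
  qed
  show ?thesis
    unfolding bounded_variation_def variation_sums_def using * by (intro bdd_aboveI[of _ "W b - W a"]) auto
qed

section \<open>Stieltjes integrals of continuous functions\<close>

lemma continuous_on_Icc_bounded:
  fixes g :: "real \<Rightarrow> real"
  assumes "continuous_on {a..b} g"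
  shows "\<exists>B. \<forall>s\<in>{a..b}. \<bar>g s\<bar> \<le> B"
proof -
  have "bounded (g ` {a..b})"
    by (intro compact_imp_bounded compact_continuous_image assms compact_Icc)
  then show ?thesis by (simp add: bounded_iff)
qed

lemma continuous_on_clamp:
  fixes H :: "real \<Rightarrow> 'a::topological_space"
  assumes "continuous_on {0..T} H" "0 \<le> t" "t \<le> T"
  shows "continuous_on UNIV (\<lambda>s. H (max 0 (min s t)))"
  using assms by (intro continuous_on_compose2[OF assms(1)] continuous_intros) auto

text \<open>Shared setting for the positive and the negative variation, whose integrals make up
  \<open>stieltjes_integral\<close>.\<close>

locale stieltjes_integrator =
  fixes T :: real and H :: "real \<Rightarrow> real"
  assumes mono: "0 \<le> x \<Longrightarrow> x \<le> y \<Longrightarrow> y \<le> T \<Longrightarrow> H x \<le> H y"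
    and cont: "continuous_on {0..T} H"
begin

definition m :: "real \<Rightarrow> real measure" where
  "m t = interval_measure (\<lambda>s. H (max 0 (min s t)))"

lemma sets_m [simp, measurable_cong]: "sets (m t) = sets borel"
  by (simp add: m_def)

lemma space_m [simp]: "space (m t) = UNIV"
  by (simp add: m_def)

lemma emeasure_m:
  assumes "0 \<le> t" "t \<le> T" "a \<le> b"
  shows "emeasure (m t) {a<..b} = H (max 0 (min b t)) - H (max 0 (min a t))"
  unfolding m_def
proof (rule emeasure_interval_measure_Ioc[OF assms(3)])
  show "H (max 0 (min x t)) \<le> H (max 0 (min y t))" if "x \<le> y" for x y
    using that assms by (intro mono) auto
  show "continuous (at_right a) (\<lambda>s. H (max 0 (min s t)))" for a
    using continuous_on_clamp[OF cont assms(1,2)]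
    by (meson UNIV_I continuous_on_eq_continuous_within continuous_within_subset subset_UNIV)
qed

text \<open>
  The integrator is frozen at the upper limit of integration, so integrals with different upper
  limits are taken with respect to different measures; these agree where both matter.
\<close>

lemma density_m_eq:
  assumes "0 \<le> u" "u \<le> v" "v \<le> T"
  shows "density (m v) (indicator {0<..u}) = density (m u) (indicator {0<..u})"
proof (rule measure_eqI_lessThan)
  have *: "emeasure (density (m t) (indicator {0<..u})) {x<..} = H u - H (max 0 (min x u))"
    if t: "u \<le> t" "t \<le> T" for x t
  proof -
    have "emeasure (density (m t) (indicator {0<..u})) {x<..} = emeasure (m t) ({0<..u} \<inter> {x<..})"
      by (subst emeasure_density) (auto simp flip: indicator_inter_arith)
    also have "{0<..u} \<inter> {x<..} = {max 0 (min x u)<..u}"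
      by auto
    also have "emeasure (m t) \<dots> = H u - H (max 0 (min x u))"
      using t assms by (subst emeasure_m) (auto simp: min_def max_def)
    finally show ?thesis .
  qed
  show "emeasure (density (m v) (indicator {0<..u})) {x<..} = emeasure (density (m u) (indicator {0<..u})) {x<..}" for x
    using assms by (simp add: *)
  show "emeasure (density (m v) (indicator {0<..u})) {x<..} < \<infinity>" for x
    using assms by (simp add: *)
qed auto

text \<open>Once both integrals are taken with respect to \<open>m v\<close>, their difference is
  the integral over \<open>{u<..v}\<close>, where \<open>g\<close> stays within
  \<open>\<epsilon>\<close> of \<open>c\<close> and the mass is \<open>H v - H u\<close>.\<close>

lemma integral_increment:
  assumes uv: "0 \<le> u" "u \<le> v" "v \<le> T"
    and g: "continuous_on {0..T} g" and bd: "\<And>s. u \<le> s \<Longrightarrow> s \<le> v \<Longrightarrow> \<bar>g s - c\<bar> \<le> \<epsilon>"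
  shows "\<bar>(LINT s:{0<..v}|m v. g s) - (LINT s:{0<..u}|m u. g s) - c * (H v - H u)\<bar> \<le> \<epsilon> * (H v - H u)"
proof -
  \<comment> \<open>Continuous extension of \<open>g\<close> to the whole line, introduced for Borel
    measurability and a global bound.\<close>
  define k where "k = (\<lambda>s. g (max 0 (min s T)))"
  have "continuous_on UNIV k"
    unfolding k_def using uv by (intro continuous_on_clamp[OF g]) auto
  then have k_meas [measurable]: "k \<in> borel_measurable borel"
    by (rule borel_measurable_continuous_onI)
  obtain B where B: "\<forall>s\<in>{0..T}. \<bar>g s\<bar> \<le> B"
    using continuous_on_Icc_bounded[OF g] by blast
  have kB: "norm (k s) \<le> B" for s
    using bspec[OF B, of "max 0 (min s T)"] uv by (auto simp: k_def)
  have kg: "(LINT s:{0<..t}|m t'. g s) = (LINT s:{0<..t}|m t'. k s)" if "t \<le> T" for t t'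
    using that by (intro set_lebesgue_integral_cong) (auto simp: k_def min_def max_def)
  have intg: "set_integrable (m t) {a<..b} k" if "0 \<le> t" "t \<le> T" "a \<le> b" for t a b
    unfolding set_integrable_def
    using kB that by (intro integrableI_bounded_set_indicator[where B = B]) (auto simp: emeasure_m)
  have mv: "emeasure (m v) {u<..v} = H v - H u"
    using emeasure_m[of v u v] uv by auto
  have k_near: "k s \<le> c + \<epsilon>" "c - \<epsilon> \<le> k s" if "u < s" "s \<le> v" for s
    using bd[of s] that uv by (auto simp: k_def abs_le_iff)
  have Huv: "H u \<le> H v" using mono uv by auto
  have const: "set_integrable (m v) {u<..v} (\<lambda>_. a)" "(LINT s:{u<..v}|m v. a) = a * (H v - H u)" for a :: real
    using mv Huv by (auto simp: set_integrable_def set_integral_const measure_def)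
  have "(LINT s:{0<..v}|m v. k s) = (LINT s:{0<..u}|m v. k s) + (LINT s:{u<..v}|m v. k s)"
  proof -
    have "{0<..v} = {0<..u} \<union> {u<..v}" using uv by auto
    then show ?thesis
      using uv by (simp only:) (intro set_integral_Un intg, auto)
  qed
  moreover have "(LINT s:{0<..u}|m v. k s) = (LINT s:{0<..u}|m u. k s)"
  proof -
    have *: "(LINT s:{0<..u}|m t. k s) = (\<integral>s. k s \<partial>density (m t) (indicator {0<..u}))" for t
      unfolding set_lebesgue_integral_def
      by (subst integral_density[symmetric]) (auto simp: ennreal_indicator)
    show ?thesis unfolding * density_m_eq[OF uv] ..
  qed
  moreover have "(LINT s:{u<..v}|m v. k s) \<le> (c + \<epsilon>) * (H v - H u)"
    unfolding const(2)[symmetric]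
    using k_near uv by (intro set_integral_mono intg const) auto
  moreover have "(c - \<epsilon>) * (H v - H u) \<le> (LINT s:{u<..v}|m v. k s)"
    unfolding const(2)[symmetric]
    using k_near uv by (intro set_integral_mono intg const) auto
  ultimately show ?thesis
    using kg[of v v] kg[of u u] uv by (auto simp: abs_le_iff algebra_simps)
qed

end

text \<open>Quantitative form of \<open>d(\<integral> g dF) = g dF\<close>. With
  \<open>c = 0\<close> it bounds the increments of the integral; with \<open>c\<close> a value of
  \<open>g\<close> on a short interval it gives the first-order approximation.\<close>

lemma stieltjes_integral_increment:
  assumes bv: "bounded_variation F 0 T" and F: "continuous_on {0..T} F"
    and uv: "0 \<le> u" "u \<le> v" "v \<le> T"
    and g: "continuous_on {0..T} g" and bd: "\<And>s. u \<le> s \<Longrightarrow> s \<le> v \<Longrightarrow> \<bar>g s - c\<bar> \<le> \<epsilon>"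
  shows "\<bar>stieltjes_integral g F v - stieltjes_integral g F u - c * (F v - F u)\<bar> \<le>
    \<epsilon> * (total_variation F 0 v - total_variation F 0 u)"
proof -
  have V: "continuous_on {0..T} (total_variation F 0)"
    using F bv continuous_total_variation[OF bv, of _ "{0..T}"]
    by (auto simp: continuous_on_eq_continuous_within)
  have inc: "\<bar>F y - F x\<bar> \<le> total_variation F 0 y - total_variation F 0 x"
    if "0 \<le> x" "x \<le> y" "y \<le> T" for x y
    using total_variation_increment(1)[OF bv that] by simp
  interpret p: stieltjes_integrator T "positive_variation F"
    unfolding positive_variation_def
  proof
    show "(total_variation F 0 x + (F x - F 0)) / 2 \<le> (total_variation F 0 y + (F y - F 0)) / 2"
      if "0 \<le> x" "x \<le> y" "y \<le> T" for x y
      using inc[OF that] by (simp add: divide_right_mono)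
    show "continuous_on {0..T} (\<lambda>s. (total_variation F 0 s + (F s - F 0)) / 2)"
      by (intro continuous_intros V F) auto
  qed
  interpret n: stieltjes_integrator T "negative_variation F"
    unfolding negative_variation_def
  proof
    show "(total_variation F 0 x - (F x - F 0)) / 2 \<le> (total_variation F 0 y - (F y - F 0)) / 2"
      if "0 \<le> x" "x \<le> y" "y \<le> T" for x y
      using inc[OF that] by (simp add: divide_right_mono)
    show "continuous_on {0..T} (\<lambda>s. (total_variation F 0 s - (F s - F 0)) / 2)"
      by (intro continuous_intros V F) auto
  qed
  let ?P = "\<lambda>t. LINT s:{0<..t}|p.m t. g s" and ?N = "\<lambda>t. LINT s:{0<..t}|n.m t. g s"
  have Z: "stieltjes_integral g F t = ?P t - ?N t" for t
    unfolding stieltjes_integral_def p.m_def n.m_def ..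
  \<comment> \<open>The two variations differ by the increment of \<open>F\<close> and add up to the
    total variation, so the two error bounds combine into one in terms of the latter.\<close>
  have F_eq: "F v - F u = (positive_variation F v - positive_variation F u) -
      (negative_variation F v - negative_variation F u)"
    and V_eq: "total_variation F 0 v - total_variation F 0 u =
      (positive_variation F v - positive_variation F u) + (negative_variation F v - negative_variation F u)"
    by (simp_all add: positive_variation_def negative_variation_def field_simps)
  have "stieltjes_integral g F v - stieltjes_integral g F u - c * (F v - F u) =
      (?P v - ?P u - c * (positive_variation F v - positive_variation F u)) -
      (?N v - ?N u - c * (negative_variation F v - negative_variation F u))"
    unfolding Z F_eq by (simp add: algebra_simps)
  then have "\<bar>stieltjes_integral g F v - stieltjes_integral g F u - c * (F v - F u)\<bar> \<le> \<epsilon> * (positive_variation F v - positive_variation F u) +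
      \<epsilon> * (negative_variation F v - negative_variation F u)"
    using p.integral_increment[OF uv g bd] n.integral_increment[OF uv g bd] by linarith
  also have "\<dots> = \<epsilon> * (total_variation F 0 v - total_variation F 0 u)"
    unfolding V_eq by (simp add: algebra_simps)
  finally show ?thesis .
qed

lemma stieltjes_integral_0: "stieltjes_integral g F 0 = 0"
  by (simp add: stieltjes_integral_def set_lebesgue_integral_def)

section \<open>Uniform convergence of almost monotone functions\<close>

lemma fine_grid:
  fixes T \<delta> :: real
  assumes "0 < \<delta>"
  shows "\<exists>K. finite K \<and> K \<subseteq> {0..T} \<and> (\<forall>t\<in>{0..T}. \<exists>a\<in>K. \<exists>b\<in>K. a \<le> t \<and> t \<le> b \<and> b - a < \<delta>)"
proof (cases "0 \<le> T")
  case True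
  \<comment> \<open>Spacing \<open>\<delta> / 2\<close> makes the gap strictly smaller than
    \<open>\<delta>\<close>; the cap at \<open>T\<close> keeps the grid inside the interval.\<close>
  define p where "p k = min T (\<delta> / 2 * real k)" for k :: nat
  define N where "N = nat \<lceil>T / (\<delta> / 2)\<rceil>"
  show ?thesis
  proof (intro exI[of _ "p ` {..Suc N}"] conjI ballI)
    show "p ` {..Suc N} \<subseteq> {0..T}" using assms True by (auto simp: p_def)
    fix t assume t: "t \<in> {0..T}"
    define k where "k = nat \<lfloor>t / (\<delta> / 2)\<rfloor>"
    have q: "0 \<le> t / (\<delta> / 2)" "t / (\<delta> / 2) \<le> T / (\<delta> / 2)"
      using t assms by (auto intro!: divide_right_mono)
    have "k \<le> N"
      unfolding k_def N_def using q by linarith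
    moreover have "real k \<le> t / (\<delta> / 2)" "t / (\<delta> / 2) \<le> real (Suc k)"
      unfolding k_def using q(1) by linarith+
    then have "\<delta> / 2 * real k \<le> t" "t \<le> \<delta> / 2 * real (Suc k)"
      using assms by (simp_all add: field_simps)
    then have "p k \<le> t" "t \<le> p (Suc k)" "p (Suc k) - p k < \<delta>"
      using t assms by (auto simp: p_def min_def algebra_simps)
    ultimately show "\<exists>a\<in>p ` {..Suc N}. \<exists>b\<in>p ` {..Suc N}. a \<le> t \<and> t \<le> b \<and> b - a < \<delta>"
      by (intro bexI[of _ "p k"] bexI[of _ "p (Suc k)"]) auto
  qed simp
qed (intro exI[of _ "{}"], simp)

text \<open>
  Polya's theorem with an error term: the sums of nonnegative terms to which it is applied are
  monotone in \<open>t\<close> only up to their last, incomplete step.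
\<close>

lemma uniform_limit_almost_monotone:
  fixes h :: "nat \<Rightarrow> real \<Rightarrow> real"
  assumes cont: "continuous_on {0..T} l"
    and lim: "\<And>t. t \<in> {0..T} \<Longrightarrow> (\<lambda>n. h n t) \<longlonglongrightarrow> l t"
    and mono: "\<And>\<epsilon>. 0 < \<epsilon> \<Longrightarrow>
      \<forall>\<^sub>F n in sequentially. \<forall>s t. 0 \<le> s \<longrightarrow> s \<le> t \<longrightarrow> t \<le> T \<longrightarrow> h n s \<le> h n t + \<epsilon>"
  shows "uniform_limit {0..T} h l sequentially"
proof (rule uniform_limitI)
  fix e :: real assume e: "e > 0"
  have "uniformly_continuous_on {0..T} l"
    using cont by (intro compact_uniformly_continuous) auto
  then obtain \<delta> where \<delta>: "\<delta> > 0"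
    "\<And>x y. x \<in> {0..T} \<Longrightarrow> y \<in> {0..T} \<Longrightarrow> dist y x < \<delta> \<Longrightarrow> dist (l y) (l x) < e / 3"
    unfolding uniformly_continuous_on_def using e by (metis zero_less_divide_iff zero_less_numeral)
  obtain K where K: "finite K" "K \<subseteq> {0..T}"
    "\<And>t. t \<in> {0..T} \<Longrightarrow> \<exists>a\<in>K. \<exists>b\<in>K. a \<le> t \<and> t \<le> b \<and> b - a < \<delta>"
    using fine_grid[OF \<delta>(1), of T] by auto
  have "\<forall>\<^sub>F n in sequentially. dist (h n a) (l a) < e / 3" if "a \<in> K" for a
    using lim[of a] that K(2) e by (intro tendstoD) auto
  then have "\<forall>\<^sub>F n in sequentially. \<forall>a\<in>K. dist (h n a) (l a) < e / 3"
    using K(1) by (simp add: eventually_ball_finite_distrib)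
  moreover have "\<forall>\<^sub>F n in sequentially. \<forall>s t. 0 \<le> s \<longrightarrow> s \<le> t \<longrightarrow> t \<le> T \<longrightarrow> h n s \<le> h n t + e / 3"
    using mono[of "e / 3"] e by simp
  ultimately show "\<forall>\<^sub>F n in sequentially. \<forall>t\<in>{0..T}. dist (h n t) (l t) < e"
  proof (eventually_elim, intro ballI)
    fix n t assume n: "\<forall>a\<in>K. dist (h n a) (l a) < e / 3"
      "\<forall>s t. 0 \<le> s \<longrightarrow> s \<le> t \<longrightarrow> t \<le> T \<longrightarrow> h n s \<le> h n t + e / 3" and t: "t \<in> {0..T}"
    obtain a b where ab: "a \<in> K" "b \<in> K" "a \<le> t" "t \<le> b" "b - a < \<delta>"
      using K(3)[OF t] by auto
    have in_T: "a \<in> {0..T}" "b \<in> {0..T}" using ab K(2) by auto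
    \<comment> \<open>The three errors of size \<open>e / 3\<close> are the defect of monotonicity,
      the convergence at the grid points and the oscillation of \<open>l\<close> between
      \<open>t\<close> and a grid point.\<close>
    have "h n a \<le> h n t + e / 3" "h n t \<le> h n b + e / 3"
      using n(2) in_T ab t by auto
    moreover have "dist (h n a) (l a) < e / 3" "dist (h n b) (l b) < e / 3"
      using n(1) ab by auto
    moreover have "dist (l t) (l a) < e / 3" "dist (l t) (l b) < e / 3"
      using \<delta>(2)[OF in_T(1) t] \<delta>(2)[OF in_T(2) t] ab by (auto simp: dist_real_def)
    ultimately show "dist (h n t) (l t) < e"
      unfolding dist_real_def by linarith
  qed
qed

section \<open>The pathwise Tanaka formula\<close>

text \<open>Steps completed by time \<open>s\<close> contribute equally to both sums, and later
  steps contribute nothing to the first. Only a step with \<open>s\<close> in its interior can lose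
  something, because \<open>r u s\<close> is not assumed to be below \<open>r u v\<close>; the loss
  is at most \<open>r u s\<close>.\<close>

lemma partition_sum_almost_monotone:
  assumes D: "finite D" and st: "s \<le> t"
    and r: "\<And>u v. 0 \<le> r u v" "\<And>u. r u u = 0"
    and small: "\<And>u v. (u, v) \<in> steps D \<Longrightarrow> u \<le> s \<Longrightarrow> s \<le> v \<Longrightarrow> r u s \<le> \<epsilon>" and \<epsilon>: "0 \<le> \<epsilon>"
  shows "partition_sum D s r \<le> partition_sum D t r + \<epsilon>"
proof -
  let ?Q = "{p \<in> steps D. fst p < s \<and> s < snd p}"
  have "partition_sum D s r \<le> (\<Sum>p\<in>steps D. (case p of (u, v) \<Rightarrow> r (min u t) (min v t)) + (if p \<in> ?Q then \<epsilon> else 0))"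
    unfolding partition_sum_min[where g = r, OF D r(2)]
  proof (rule sum_mono, clarify)
    fix u v assume uv: "(u, v) \<in> steps D"
    show "r (min u s) (min v s) \<le> r (min u t) (min v t) + (if (u, v) \<in> ?Q then \<epsilon> else 0)"
      using st r small[OF uv] stepsD(3)[OF uv] uv by (auto simp: min_def add_increasing)
  qed
  also have "\<dots> = partition_sum D t r + \<epsilon> * card ?Q"
    unfolding partition_sum_min[where g = r, OF D r(2)] sum.distrib
    using D by (simp add: sum.inter_filter[symmetric] mult.commute)
  \<comment> \<open>Two different steps cannot both have \<open>s\<close> in their interior.\<close>
  also have "\<epsilon> * card ?Q \<le> \<epsilon> * 1"
  proof (intro mult_left_mono \<epsilon>)
    have "p = q" if "p \<in> ?Q" "q \<in> ?Q" for p q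
    proof -
      obtain u v a b where [simp]: "p = (u, v)" "q = (a, b)" by (metis surj_pair)
      have uv: "(u, v) \<in> steps D" and ab: "(a, b) \<in> steps D" using that by auto
      note s1 = stepsD[OF uv] and s2 = stepsD[OF ab]
      show ?thesis
        using s1(4)[OF s2(1)] s1(4)[OF s2(2)] s2(4)[OF s1(1)] s2(4)[OF s1(2)] that by auto
    qed
    then have "card ?Q \<le> 1"
      using card_le_Suc0_iff_eq[of ?Q] D by auto
    then show "real (card ?Q) \<le> 1" by simp
  qed
  finally show ?thesis by simp
qed

text \<open>One of the two monotone parts of \<open>f'\<close>. The bounds \<open>l\<close> and
  \<open>r\<close> are meant to enclose the range of the path; the interval between them has finite
  mass, so uniform limits can be integrated over it.\<close>

locale monotone_density =
  fixes g :: "real \<Rightarrow> real" and l r :: real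
  assumes mono: "x \<le> y \<Longrightarrow> g x \<le> g y"
    and right_cont: "continuous (at_right x) g"
    and l_le_r: "l \<le> r"
begin

abbreviation m where "m \<equiv> interval_measure g"

text \<open>Contribution of one step from \<open>a\<close> to \<open>b\<close> to the integral of
  the discrete local time against \<open>dg\<close>. For \<open>a\<close> and \<open>b\<close> in
  \<open>[l, r]\<close> it is the first-order Taylor remainder at \<open>a\<close>, evaluated at
  \<open>b\<close>, of a primitive of \<open>g\<close>.\<close>

definition kernel :: "real \<Rightarrow> real \<Rightarrow> real" where
  "kernel a b = (LINT x:{l<..r}|m. indicator {min a b<..max a b} x * \<bar>b - x\<bar>)"

lemma emeasure_m: "a \<le> b \<Longrightarrow> emeasure m {a<..b} = g b - g a"
  using mono right_cont by (intro emeasure_interval_measure_Ioc) auto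

lemma measure_m: "a \<le> b \<Longrightarrow> measure m {a<..b} = g b - g a"
  using emeasure_m[of a b] mono[of a b] by (simp add: measure_def)

lemma set_integrable_bounded:
  fixes k :: "real \<Rightarrow> real"
  assumes [measurable]: "k \<in> borel_measurable borel" and "\<And>x. l < x \<Longrightarrow> x \<le> r \<Longrightarrow> \<bar>k x\<bar> \<le> B"
  shows "set_integrable m {l<..r} k"
  unfolding set_integrable_def
  using assms(2) l_le_r by (intro integrableI_bounded_set_indicator[where B = B]) (auto simp: emeasure_m)

lemma set_integral_close:
  assumes "set_integrable m {l<..r} j" "set_integrable m {l<..r} k"
    and "\<And>x. l < x \<Longrightarrow> x \<le> r \<Longrightarrow> \<bar>j x - k x\<bar> \<le> \<epsilon>"
  shows "\<bar>(LINT x:{l<..r}|m. j x) - (LINT x:{l<..r}|m. k x)\<bar> \<le> \<epsilon> * (g r - g l)"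
proof -
  have const: "set_integrable m {l<..r} (\<lambda>_. c)" "(LINT x:{l<..r}|m. c) = c * (g r - g l)" for c :: real
    using set_integrable_bounded[of "\<lambda>_. c" "\<bar>c\<bar>"] emeasure_m[OF l_le_r] measure_m[OF l_le_r]
    by (auto simp: set_integral_const)
  have d: "set_integrable m {l<..r} (\<lambda>x. j x - k x)"
    using assms(1,2) by (rule set_integral_diff(1))
  have eq: "(LINT x:{l<..r}|m. j x) - (LINT x:{l<..r}|m. k x) = (LINT x:{l<..r}|m. j x - k x)"
    using set_integral_diff(2)[OF assms(1,2)] ..
  have "(LINT x:{l<..r}|m. j x - k x) \<le> (LINT x:{l<..r}|m. \<epsilon>)"
    using assms(3) by (intro set_integral_mono d const(1)) (auto simp: abs_le_iff)
  moreover have "(LINT x:{l<..r}|m. - \<epsilon>) \<le> (LINT x:{l<..r}|m. j x - k x)"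
    using assms(3) by (intro set_integral_mono d const(1)) (force simp: abs_le_iff)+
  ultimately show ?thesis
    unfolding eq const(2) by (auto simp: abs_le_iff)
qed

lemma kernel_integrable: "set_integrable m {l<..r} (\<lambda>x. indicator {min a b<..max a b} x * \<bar>b - x\<bar>)"
  by (rule set_integrable_bounded[where B = "\<bar>b - a\<bar>"])
    (auto simp: indicator_def split: if_splits)

lemma kernel_nonneg: "0 \<le> kernel a b"
  unfolding kernel_def set_lebesgue_integral_def by (intro Bochner_Integration.integral_nonneg) auto

lemma kernel_refl: "kernel a a = 0"
  by (simp add: kernel_def set_lebesgue_integral_def)

lemma kernel_le: "kernel a b \<le> \<bar>b - a\<bar> * (g r - g l)"
proof -
  have "\<bar>(LINT x:{l<..r}|m. indicator {min a b<..max a b} x * \<bar>b - x\<bar>) - (LINT x:{l<..r}|m. 0)\<bar> \<le>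
      \<bar>b - a\<bar> * (g r - g l)"
    by (intro set_integral_close kernel_integrable set_integrable_bounded[where B = 0])
      (auto simp: indicator_def split: if_splits)
  then show ?thesis
    using kernel_nonneg[of a b] by (simp add: kernel_def set_lebesgue_integral_def)
qed

lemma g_measurable [measurable]: "g \<in> borel_measurable borel"
  using mono by (intro borel_measurable_mono) (auto simp: mono_def)

lemma sigma_finite_m: "sigma_finite_measure m"
  using mono right_cont by (intro sigma_finite_interval_measure) auto

text \<open>Write the distance to \<open>b\<close> as the length of an interval and apply Fubini.\<close>

lemma kernel_forward:
  assumes "l \<le> a" "a \<le> b" "b \<le> r"
  shows "kernel a b = (LINT y:{a..b}|lborel. g y - g a)"
proof -
  interpret M: sigma_finite_measure m by (rule sigma_finite_m)
  interpret pair_sigma_finite m lborel ..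
  have "kernel a b = enn2real (\<integral>\<^sup>+x. ennreal (indicator {a<..b} x * (b - x)) \<partial>m)"
    unfolding kernel_def set_lebesgue_integral_def using assms
    by (subst integral_eq_nn_integral)
      (auto intro!: arg_cong[where f = enn2real] nn_integral_cong split: split_indicator)
  also have "(\<integral>\<^sup>+x. ennreal (indicator {a<..b} x * (b - x)) \<partial>m) =
      (\<integral>\<^sup>+x. (\<integral>\<^sup>+y. indicator {a<..b} x * (indicator {x..} y * indicator {..b} y) \<partial>lborel) \<partial>m)"
  proof (rule nn_integral_cong)
    fix x
    have "(\<integral>\<^sup>+y. indicator {a<..b} x * (indicator {x..} y * indicator {..b} y) \<partial>lborel) =
       (\<integral>\<^sup>+y. indicator {a<..b} x * indicator {x..b} y \<partial>lborel)"
      by (intro nn_integral_cong) (auto split: split_indicator)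
    also have "\<dots> = ennreal (indicator {a<..b} x * (b - x))"
      by (subst nn_integral_cmult_indicator) (auto split: split_indicator)
    finally show "ennreal (indicator {a<..b} x * (b - x)) =
      (\<integral>\<^sup>+y. indicator {a<..b} x * (indicator {x..} y * indicator {..b} y) \<partial>lborel)" ..
  qed
  also have "\<dots> = (\<integral>\<^sup>+y. (\<integral>\<^sup>+x. indicator {a<..b} x * (indicator {x..} y * indicator {..b} y) \<partial>m) \<partial>lborel)"
  proof (rule Fubini'[symmetric])
    have [measurable]: "(\<lambda>p. indicator {fst p..} (snd p) :: ennreal) \<in> borel_measurable (m \<Otimes>\<^sub>M lborel)"
      unfolding indicator_def by simp
    show "(\<lambda>(x, y). indicator {a<..b} x * (indicator {x..} y * indicator {..b} y) :: ennreal)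
        \<in> borel_measurable (m \<Otimes>\<^sub>M lborel)"
      unfolding case_prod_beta by measurable
  qed
  also have "\<dots> = (\<integral>\<^sup>+y. ennreal (indicator {a..b} y * (g y - g a)) \<partial>lborel)"
  proof (rule nn_integral_cong)
    fix y
    have "(\<integral>\<^sup>+x. indicator {a<..b} x * (indicator {x..} y * indicator {..b} y) \<partial>m) =
        (\<integral>\<^sup>+x. indicator {..b} y * indicator {a<..y} x \<partial>m)"
      by (intro nn_integral_cong) (auto split: split_indicator)
    also have "\<dots> = indicator {..b} y * emeasure m {a<..y}"
      by (simp add: nn_integral_cmult_indicator)
    also have "\<dots> = ennreal (indicator {a..b} y * (g y - g a))"
      by (cases "a \<le> y") (auto simp: emeasure_m split: split_indicator)
    finally show "(\<integral>\<^sup>+x. indicator {a<..b} x * (indicator {x..} y * indicator {..b} y) \<partial>m) =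
      ennreal (indicator {a..b} y * (g y - g a))" .
  qed
  also have "enn2real \<dots> = (LINT y:{a..b}|lborel. g y - g a)"
    unfolding set_lebesgue_integral_def using mono
    by (subst integral_eq_nn_integral) (auto split: split_indicator)
  finally show ?thesis .
qed

text \<open>Fubini again, now with \<open>x - b\<close> as the length of \<open>{b..<x}\<close>.
  Leaving out \<open>x\<close> makes the inner integral run over \<open>{y<..a}\<close>, whose mass
  is exactly \<open>g a - g y\<close> even if \<open>g\<close> jumps at \<open>y\<close>.\<close>

lemma kernel_backward:
  assumes "l \<le> b" "b \<le> a" "a \<le> r"
  shows "kernel a b = (LINT y:{b..a}|lborel. g a - g y)"
proof -
  interpret M: sigma_finite_measure m by (rule sigma_finite_m)
  interpret pair_sigma_finite m lborel ..
  have "kernel a b = enn2real (\<integral>\<^sup>+x. ennreal (indicator {b<..a} x * (x - b)) \<partial>m)"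
    unfolding kernel_def set_lebesgue_integral_def using assms
    by (subst integral_eq_nn_integral)
      (auto intro!: arg_cong[where f = enn2real] nn_integral_cong split: split_indicator)
  also have "(\<integral>\<^sup>+x. ennreal (indicator {b<..a} x * (x - b)) \<partial>m) =
      (\<integral>\<^sup>+x. (\<integral>\<^sup>+y. indicator {b<..a} x * (indicator {..<x} y * indicator {b..} y) \<partial>lborel) \<partial>m)"
  proof (rule nn_integral_cong)
    fix x
    have "(\<integral>\<^sup>+y. indicator {b<..a} x * (indicator {..<x} y * indicator {b..} y) \<partial>lborel) =
       (\<integral>\<^sup>+y. indicator {b<..a} x * indicator {b..<x} y \<partial>lborel)"
      by (intro nn_integral_cong) (auto split: split_indicator)
    also have "\<dots> = ennreal (indicator {b<..a} x * (x - b))"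
      by (subst nn_integral_cmult_indicator) (auto split: split_indicator)
    finally show "ennreal (indicator {b<..a} x * (x - b)) =
      (\<integral>\<^sup>+y. indicator {b<..a} x * (indicator {..<x} y * indicator {b..} y) \<partial>lborel)" ..
  qed
  also have "\<dots> = (\<integral>\<^sup>+y. (\<integral>\<^sup>+x. indicator {b<..a} x * (indicator {..<x} y * indicator {b..} y) \<partial>m) \<partial>lborel)"
  proof (rule Fubini'[symmetric])
    have [measurable]: "(\<lambda>p. indicator {..<fst p} (snd p) :: ennreal) \<in> borel_measurable (m \<Otimes>\<^sub>M lborel)"
      unfolding indicator_def by simp
    show "(\<lambda>(x, y). indicator {b<..a} x * (indicator {..<x} y * indicator {b..} y) :: ennreal)
        \<in> borel_measurable (m \<Otimes>\<^sub>M lborel)"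
      unfolding case_prod_beta by measurable
  qed
  also have "\<dots> = (\<integral>\<^sup>+y. ennreal (indicator {b..a} y * (g a - g y)) \<partial>lborel)"
  proof (rule nn_integral_cong)
    fix y
    have "(\<integral>\<^sup>+x. indicator {b<..a} x * (indicator {..<x} y * indicator {b..} y) \<partial>m) =
        (\<integral>\<^sup>+x. indicator {b..} y * indicator {y<..a} x \<partial>m)"
      by (intro nn_integral_cong) (auto split: split_indicator)
    also have "\<dots> = indicator {b..} y * emeasure m {y<..a}"
      by (simp add: nn_integral_cmult_indicator)
    also have "\<dots> = ennreal (indicator {b..a} y * (g a - g y))"
      by (cases "y \<le> a") (auto simp: emeasure_m split: split_indicator)
    finally show "(\<integral>\<^sup>+x. indicator {b<..a} x * (indicator {..<x} y * indicator {b..} y) \<partial>m) =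
      ennreal (indicator {b..a} y * (g a - g y))" .
  qed
  also have "enn2real \<dots> = (LINT y:{b..a}|lborel. g a - g y)"
    unfolding set_lebesgue_integral_def using mono
    by (subst integral_eq_nn_integral) (auto split: split_indicator)
  finally show ?thesis .
qed

text \<open>Interchange of the finite sum with the integral; this is where remainders of Taylor
  expansions become local times.\<close>

lemma partition_sum_kernel:
  assumes "finite D"
  shows "set_integrable m {l<..r} (discrete_local_time D X t)"
    and "partition_sum D t (\<lambda>u v. kernel (X u) (X v)) = (LINT x:{l<..r}|m. discrete_local_time D X t x)"
proof -
  let ?I = "{(u, v) \<in> steps D. u \<le> t}"
  let ?k = "\<lambda>p x. indicator {l<..r} x *\<^sub>R (case p of (u, v) \<Rightarrow>
    indicator {min (X u) (X (min v t))<..max (X u) (X (min v t))} x * \<bar>X (min v t) - x\<bar>)"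
  have eq: "indicator {l<..r} x *\<^sub>R discrete_local_time D X t x = (\<Sum>p\<in>?I. ?k p x)" for x
    unfolding discrete_local_time_def partition_sum_def by (simp add: sum_distrib_left)
  have int: "integrable m (?k p)" for p
    using kernel_integrable unfolding set_integrable_def by (cases p) simp
  show "set_integrable m {l<..r} (discrete_local_time D X t)"
    unfolding set_integrable_def eq by (intro Bochner_Integration.integrable_sum int)
  show "partition_sum D t (\<lambda>u v. kernel (X u) (X v)) = (LINT x:{l<..r}|m. discrete_local_time D X t x)"
    unfolding set_lebesgue_integral_def eq Bochner_Integration.integral_sum[OF int]
    by (auto simp: partition_sum_def kernel_def set_lebesgue_integral_def intro!: sum.cong)
qed

text \<open>The limit is \<open>\<integral> L t x dg(x)\<close>. Uniform convergence of the discrete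
  local times gives convergence for each \<open>t\<close>, and joint continuity of \<open>L\<close>
  gives continuity in \<open>t\<close>. Kernels are nonnegative and small over short time intervals,
  so the sums are almost monotone and the convergence is uniform in \<open>t\<close>.\<close>

lemma kernel_sums_uniform_limit:
  assumes P: "refining_partitions T P" and X: "has_continuous_local_time P T X"
  obtains \<Lambda> where "continuous_on {0..T} \<Lambda>"
    and "\<And>s t. 0 \<le> s \<Longrightarrow> s \<le> t \<Longrightarrow> t \<le> T \<Longrightarrow> \<Lambda> s \<le> \<Lambda> t"
    and "uniform_limit {0..T} (\<lambda>n t. partition_sum (P n) t (\<lambda>u v. kernel (X u) (X v))) \<Lambda> sequentially"
proof -
  obtain L where L: "\<And>t. t \<in> {0..T} \<Longrightarrow> uniform_limit UNIV (\<lambda>n. discrete_local_time (P n) X t) (L t) sequentially"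
    "\<And>t. t \<in> {0..T} \<Longrightarrow> continuous_on UNIV (L t)"
    "continuous_on ({0..T} \<times> UNIV) (\<lambda>(t, x). L t x)"
    and X_cont: "continuous_on {0..T} X"
    using X unfolding has_continuous_local_time_def by blast
  define \<Lambda> where "\<Lambda> t = (LINT x:{l<..r}|m. L t x)" for t
  let ?h = "\<lambda>n t. partition_sum (P n) t (\<lambda>u v. kernel (X u) (X v))"
  \<comment> \<open>Strictly positive even if \<open>g\<close> is constant on \<open>[l, r]\<close>,
    so division by \<open>c\<close> is safe.\<close>
  define c where "c = g r - g l + 1"
  have c: "g r - g l \<le> c" "0 < c" using mono[OF l_le_r] by (auto simp: c_def)
  note fin = partition_ofD(1)[OF refining_partitionsD(1)[OF P]]
  have L_int: "set_integrable m {l<..r} (L t)" if t: "t \<in> {0..T}" for t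
  proof -
    have "continuous_on {l..r} (L t)"
      using L(2)[OF t] continuous_on_subset by blast
    then obtain B where B: "\<forall>x\<in>{l..r}. \<bar>L t x\<bar> \<le> B"
      using continuous_on_Icc_bounded by blast
    have [measurable]: "L t \<in> borel_measurable borel"
      using L(2)[OF t] by (rule borel_measurable_continuous_onI)
    show ?thesis
      using B by (intro set_integrable_bounded[where B = B]) auto
  qed
  have lim: "(\<lambda>n. ?h n t) \<longlonglongrightarrow> \<Lambda> t" if t: "t \<in> {0..T}" for t
  proof (rule tendstoI)
    fix e :: real assume e: "e > 0"
    have "\<forall>\<^sub>F n in sequentially. \<forall>x\<in>UNIV. dist (discrete_local_time (P n) X t x) (L t x) < e / (2 * c)"
      using uniform_limitD[OF L(1)[OF t]] e c by auto
    then show "\<forall>\<^sub>F n in sequentially. dist (?h n t) (\<Lambda> t) < e"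
    proof eventually_elim
      case (elim n)
      have "\<bar>?h n t - \<Lambda> t\<bar> \<le> e / (2 * c) * (g r - g l)"
        unfolding partition_sum_kernel(2)[OF fin] \<Lambda>_def using elim
        by (intro set_integral_close partition_sum_kernel(1)[OF fin] L_int[OF t])
          (auto simp: dist_real_def intro: less_imp_le)
      also have "\<dots> \<le> e / (2 * c) * c"
        using e c by (intro mult_left_mono) auto
      also have "\<dots> < e" using e c by simp
      finally show ?case by (simp add: dist_real_def)
    qed
  qed
  have cont: "continuous_on {0..T} \<Lambda>"
    unfolding continuous_on_iff
  proof (intro ballI allI impI)
    fix t and e :: real assume t: "t \<in> {0..T}" and e: "e > 0"
    have "uniformly_continuous_on ({0..T} \<times> {l..r}) (\<lambda>(t, x). L t x)"
      by (intro compact_uniformly_continuous compact_Times compact_Icc continuous_on_subset[OF L(3)]) auto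
    moreover have "e / (2 * c) > 0" using e c by auto
    ultimately obtain \<delta> where \<delta>: "\<delta> > 0" "\<And>p q. p \<in> {0..T} \<times> {l..r} \<Longrightarrow> q \<in> {0..T} \<times> {l..r} \<Longrightarrow>
        dist q p < \<delta> \<Longrightarrow> dist (case q of (t, x) \<Rightarrow> L t x) (case p of (t, x) \<Rightarrow> L t x) < e / (2 * c)"
      unfolding uniformly_continuous_on_def by meson
    show "\<exists>d>0. \<forall>s\<in>{0..T}. dist s t < d \<longrightarrow> dist (\<Lambda> s) (\<Lambda> t) < e"
    proof (intro exI[of _ \<delta>] conjI \<delta>(1) ballI impI)
      fix s assume s: "s \<in> {0..T}" "dist s t < \<delta>"
      have "\<bar>\<Lambda> s - \<Lambda> t\<bar> \<le> e / (2 * c) * (g r - g l)"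
        unfolding \<Lambda>_def
      proof (intro set_integral_close L_int s(1) t)
        fix x assume "l < x" "x \<le> r"
        then show "\<bar>L s x - L t x\<bar> \<le> e / (2 * c)"
          using \<delta>(2)[of "(t, x)" "(s, x)"] s t by (auto simp: dist_Pair_Pair dist_real_def)
      qed
      also have "\<dots> \<le> e / (2 * c) * c"
        using e c by (intro mult_left_mono) auto
      also have "\<dots> < e" using e c by simp
      finally show "dist (\<Lambda> s) (\<Lambda> t) < e" by (simp add: dist_real_def)
    qed
  qed
  have almost_mono: "\<forall>\<^sub>F n in sequentially. \<forall>s t. 0 \<le> s \<longrightarrow> s \<le> t \<longrightarrow> t \<le> T \<longrightarrow> ?h n s \<le> ?h n t + \<epsilon>"
    if \<epsilon>: "\<epsilon> > 0" for \<epsilon>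
  proof -
    have "uniformly_continuous_on {0..T} X"
      using X_cont by (intro compact_uniformly_continuous) auto
    moreover have "\<epsilon> / c > 0" using \<epsilon> c by auto
    ultimately obtain \<delta> where \<delta>: "\<delta> > 0"
      "\<And>x y. x \<in> {0..T} \<Longrightarrow> y \<in> {0..T} \<Longrightarrow> dist y x < \<delta> \<Longrightarrow> dist (X y) (X x) < \<epsilon> / c"
      unfolding uniformly_continuous_on_def by meson
    show ?thesis
      using order_tendstoD(2)[OF refining_partitionsD(2)[OF P] \<delta>(1)]
    proof (eventually_elim, intro allI impI)
      fix n s t assume n: "mesh (P n) < \<delta>" and st: "0 \<le> s" "s \<le> t" "t \<le> T"
      show "?h n s \<le> ?h n t + \<epsilon>"
      proof (rule partition_sum_almost_monotone[OF fin st(2)])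
        fix u v assume uv: "(u, v) \<in> steps (P n)" "u \<le> s" "s \<le> v"
        have "u \<in> {0..T}"
          using partition_ofD(4)[OF refining_partitionsD(1)[OF P]] stepsD(1)[OF uv(1)] by auto
        moreover have "dist s u < \<delta>"
          using step_length_le_mesh[OF fin uv(1)] n uv by (auto simp: dist_real_def)
        ultimately have d: "\<bar>X s - X u\<bar> \<le> \<epsilon> / c"
          using \<delta>(2)[of u s] st by (auto simp: dist_real_def)
        have "kernel (X u) (X s) \<le> \<bar>X s - X u\<bar> * (g r - g l)"
          by (rule kernel_le)
        also have "\<dots> \<le> \<epsilon> / c * c"
          using d c mono[OF l_le_r] by (intro mult_mono) auto
        also have "\<dots> = \<epsilon>" using c by simp
        finally show "kernel (X u) (X s) \<le> \<epsilon>" .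
      qed (use \<epsilon> kernel_nonneg kernel_refl in auto)
    qed
  qed
  show thesis
  proof
    show "continuous_on {0..T} \<Lambda>" by (rule cont)
    show "uniform_limit {0..T} ?h \<Lambda> sequentially"
      using cont lim almost_mono by (rule uniform_limit_almost_monotone)
    fix s t assume st: "0 \<le> s" "s \<le> t" "t \<le> T"
    show "\<Lambda> s \<le> \<Lambda> t"
    \<comment> \<open>The defect of monotonicity disappears in the limit.\<close>
    proof (rule field_le_epsilon)
      fix \<epsilon> :: real assume "\<epsilon> > 0"
      then have "\<forall>\<^sub>F n in sequentially. ?h n s \<le> ?h n t + \<epsilon>"
        using almost_mono[of \<epsilon>] st by (auto elim: eventually_mono)
      moreover have "(\<lambda>n. ?h n s) \<longlonglongrightarrow> \<Lambda> s" "(\<lambda>n. ?h n t + \<epsilon>) \<longlonglongrightarrow> \<Lambda> t + \<epsilon>"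
        using st by (auto intro!: lim tendsto_intros)
      ultimately show "\<Lambda> s \<le> \<Lambda> t + \<epsilon>"
        by (intro tendsto_le[OF sequentially_bot]) auto
    qed
  qed
qed

end

section \<open>Decomposition of the density and the Tanaka formula\<close>

lemma continuous_at_right_clamp:
  fixes k :: "real \<Rightarrow> real"
  assumes "l \<le> r" and k: "\<And>z. l \<le> z \<Longrightarrow> z \<le> r \<Longrightarrow> continuous (at z within {z..r}) k"
  shows "continuous (at_right x) (\<lambda>y. k (max l (min y r)))"
proof (rule continuous_within_compose2[where f = "\<lambda>y. max l (min y r)" and g = k])
  show "continuous (at_right x) (\<lambda>y. max l (min y r))"
    by (intro continuous_intros)
  \<comment> \<open>The clamp maps \<open>{x<..}\<close> into the interval from the clamped
    \<open>x\<close> up to \<open>r\<close>, where the one-sided hypothesis applies.\<close>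
  show "continuous (at (max l (min x r)) within (\<lambda>y. max l (min y r)) ` {x<..}) k"
    using assms(1) by (intro continuous_within_subset[OF k]) auto
qed

lemma continuous_within_Icc_at_right:
  assumes "continuous (at_right z) F"
  shows "continuous (at z within {z..r}) F"
  using assms unfolding continuous_within
  by (rule tendsto_mono[rotated]) (unfold at_within_def, intro inf_mono, auto)

text \<open>Jordan decomposition into the total variation \<open>V\<close> and \<open>V - F\<close>,
  both right-continuous because \<open>V\<close> inherits this from \<open>F\<close>. Freezing them
  outside \<open>[l, r]\<close> gives monotone functions on the whole line, as
  \<open>interval_measure\<close> expects.\<close>

lemma right_continuous_decomposition:
  fixes F :: "real \<Rightarrow> real"
  assumes lr: "l \<le> r" and bv: "bounded_variation F l r" and F: "\<And>x. continuous (at_right x) F"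
  obtains g h where "monotone_density g l r" "monotone_density h l r"
    "\<And>x. l \<le> x \<Longrightarrow> x \<le> r \<Longrightarrow> F x = g x - h x"
proof
  let ?c = "\<lambda>x. max l (min x r)"
  have inc: "\<bar>F y - F x\<bar> \<le> total_variation F l y - total_variation F l x" if "l \<le> x" "x \<le> y" "y \<le> r" for x y
    using total_variation_increment(1)[OF bv that] by simp
  have Fc: "continuous (at z within {z..r}) F" for z
    using F by (rule continuous_within_Icc_at_right)
  have Vc: "continuous (at z within {z..r}) (total_variation F l)" if "l \<le> z" "z \<le> r" for z
    using that by (intro continuous_total_variation[OF bv] Fc) auto
  show "monotone_density (\<lambda>x. total_variation F l (?c x)) l r"
  proof
    show "total_variation F l (?c x) \<le> total_variation F l (?c y)" if "x \<le> y" for x y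
      using inc[of "?c x" "?c y"] that lr by (auto simp: max_def min_def split: if_splits)
    show "continuous (at_right x) (\<lambda>x. total_variation F l (?c x))" for x
      using lr Vc by (rule continuous_at_right_clamp)
  qed (rule lr)
  show "monotone_density (\<lambda>x. total_variation F l (?c x) - F (?c x)) l r"
  proof
    show "total_variation F l (?c x) - F (?c x) \<le> total_variation F l (?c y) - F (?c y)" if "x \<le> y" for x y
      using inc[of "?c x" "?c y"] that lr by (auto simp: max_def min_def split: if_splits)
    show "continuous (at_right x) (\<lambda>x. total_variation F l (?c x) - F (?c x))" for x
      using lr Vc Fc by (intro continuous_intros continuous_at_right_clamp)
  qed (rule lr)
  show "F x = total_variation F l (?c x) - (total_variation F l (?c x) - F (?c x))" if "l \<le> x" "x \<le> r" for x
    using that by simp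
qed

lemma (in monotone_density) set_integrable_lborel: "set_integrable lborel {a..b} g"
proof (cases "a \<le> b")
  case True
  show ?thesis
    unfolding set_integrable_def
  proof (rule integrableI_bounded_set_indicator[where B = "\<bar>g a\<bar> + \<bar>g b\<bar>"])
    show "AE x in lborel. x \<in> {a..b} \<longrightarrow> norm (g x) \<le> \<bar>g a\<bar> + \<bar>g b\<bar>"
      using mono[of a] mono[of _ b] by (intro AE_I2) (force simp: abs_le_iff)
  qed (use True in auto)
qed simp

text \<open>Tanaka formula for a single step: on \<open>[l, r]\<close> the increments of
  \<open>f\<close> are those of a primitive of \<open>g\<close> minus those of a primitive of
  \<open>h\<close>, and each kernel is the Taylor remainder of such a primitive.\<close>

lemma tanaka_remainder:
  fixes f f' :: "real \<Rightarrow> real"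
  assumes f: "absolutely_continuous_with_density f f'"
    and "monotone_density g l r" "monotone_density h l r"
    and f': "\<And>x. l \<le> x \<Longrightarrow> x \<le> r \<Longrightarrow> f' x = g x - h x"
    and ab: "l \<le> a" "a \<le> r" "l \<le> b" "b \<le> r"
  shows "f b - f a - f' a * (b - a) = monotone_density.kernel g l r a b - monotone_density.kernel h l r a b"
proof -
  interpret g: monotone_density g l r by fact
  interpret h: monotone_density h l r by fact
  have const: "set_integrable lborel {x..y} (\<lambda>_. c)" "x \<le> y \<Longrightarrow> (LINT z:{x..y}|lborel. c) = c * (y - x)"
    for x y c :: real
    by (auto intro!: borel_integrable_atLeastAtMost' simp: set_integral_const)
  have f_eq: "f y - f x = (LINT z:{x..y}|lborel. g z) - (LINT z:{x..y}|lborel. h z)"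
    if "l \<le> x" "x \<le> y" "y \<le> r" for x y
  proof -
    have "f y - f x = (LINT z:{x..y}|lborel. f' z)"
      using f that by (auto simp: absolutely_continuous_with_density_def)
    also have "\<dots> = (LINT z:{x..y}|lborel. g z - h z)"
      using that f' by (intro set_lebesgue_integral_cong) auto
    also have "\<dots> = (LINT z:{x..y}|lborel. g z) - (LINT z:{x..y}|lborel. h z)"
      by (intro set_integral_diff g.set_integrable_lborel h.set_integrable_lborel)
    finally show ?thesis .
  qed
  show ?thesis
  proof (cases "a \<le> b")
    case True
    have "(LINT y:{a..b}|lborel. g y - g a) = (LINT y:{a..b}|lborel. g y) - g a * (b - a)"
      "(LINT y:{a..b}|lborel. h y - h a) = (LINT y:{a..b}|lborel. h y) - h a * (b - a)"
      using True by (subst set_integral_diff; simp add: const g.set_integrable_lborel h.set_integrable_lborel)+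
    moreover have "f' a * (b - a) = g a * (b - a) - h a * (b - a)"
      by (simp add: f'[OF ab(1,2)] algebra_simps)
    ultimately show ?thesis
      using f_eq[of a b] g.kernel_forward[of a b] h.kernel_forward[of a b] True ab by linarith
  next
    case False
    have "(LINT y:{b..a}|lborel. g a - g y) = g a * (a - b) - (LINT y:{b..a}|lborel. g y)"
      "(LINT y:{b..a}|lborel. h a - h y) = h a * (a - b) - (LINT y:{b..a}|lborel. h y)"
      using False by (subst set_integral_diff; simp add: const g.set_integrable_lborel h.set_integrable_lborel)+
    moreover have "f' a * (b - a) = h a * (a - b) - g a * (a - b)"
      by (simp add: f'[OF ab(1,2)] algebra_simps)
    ultimately show ?thesis
      using f_eq[of b a] g.kernel_backward[of b a] h.kernel_backward[of b a] False ab by linarith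
  qed
qed

text \<open>Summing \<open>tanaka_remainder\<close> over the steps telescopes the increments of
  \<open>f\<close> and gives an identity that is exact for every partition; only the two kernel sums
  depend on a limit. The monotone limits \<open>\<Lambda>1\<close> and \<open>\<Lambda>2\<close>
  later serve as control functions.\<close>

lemma pathwise_tanaka:
  assumes P: "refining_partitions T P" and X: "has_continuous_local_time P T X"
    and f: "absolutely_continuous_with_density f f'"
    and f'_right: "\<And>x. continuous (at_right x) f'" and f'_bv: "\<And>a b. bounded_variation f' a b"
  obtains \<Lambda>1 \<Lambda>2 where "continuous_on {0..T} \<Lambda>1" "continuous_on {0..T} \<Lambda>2"
    and "\<And>s t. 0 \<le> s \<Longrightarrow> s \<le> t \<Longrightarrow> t \<le> T \<Longrightarrow> \<Lambda>1 s \<le> \<Lambda>1 t"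
    and "\<And>s t. 0 \<le> s \<Longrightarrow> s \<le> t \<Longrightarrow> t \<le> T \<Longrightarrow> \<Lambda>2 s \<le> \<Lambda>2 t"
    and "uniform_limit {0..T} (\<lambda>n t. riemann_sum (P n) (\<lambda>s. f' (X s)) X t)
      (\<lambda>t. f (X t) - f (X 0) - (\<Lambda>1 t - \<Lambda>2 t)) sequentially"
proof -
  have "continuous_on {0..T} X"
    using X by (simp add: has_continuous_local_time_def)
  then obtain B where B: "\<forall>s\<in>{0..T}. \<bar>X s\<bar> \<le> B"
    using continuous_on_Icc_bounded by blast
  define K where "K = \<bar>B\<bar>"
  have K: "- K \<le> K" "- K \<le> X s" "X s \<le> K" if "0 \<le> s" "s \<le> T" for s
    using bspec[OF B, of s] that by (auto simp: K_def)
  have K0: "- K \<le> K" by (simp add: K_def)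
  obtain g h where gh: "monotone_density g (- K) K" "monotone_density h (- K) K"
    "\<And>x. - K \<le> x \<Longrightarrow> x \<le> K \<Longrightarrow> f' x = g x - h x"
    using right_continuous_decomposition[OF K0 f'_bv f'_right] by blast
  interpret g: monotone_density g "- K" K by fact
  interpret h: monotone_density h "- K" K by fact
  obtain \<Lambda>1 where \<Lambda>1: "continuous_on {0..T} \<Lambda>1"
    "\<And>s t. 0 \<le> s \<Longrightarrow> s \<le> t \<Longrightarrow> t \<le> T \<Longrightarrow> \<Lambda>1 s \<le> \<Lambda>1 t"
    "uniform_limit {0..T} (\<lambda>n t. partition_sum (P n) t (\<lambda>u v. g.kernel (X u) (X v))) \<Lambda>1 sequentially"
    using g.kernel_sums_uniform_limit[OF P X] by blast
  obtain \<Lambda>2 where \<Lambda>2: "continuous_on {0..T} \<Lambda>2"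
    "\<And>s t. 0 \<le> s \<Longrightarrow> s \<le> t \<Longrightarrow> t \<le> T \<Longrightarrow> \<Lambda>2 s \<le> \<Lambda>2 t"
    "uniform_limit {0..T} (\<lambda>n t. partition_sum (P n) t (\<lambda>u v. h.kernel (X u) (X v))) \<Lambda>2 sequentially"
    using h.kernel_sums_uniform_limit[OF P X] by blast
  have eq: "riemann_sum (P n) (\<lambda>s. f' (X s)) X t = f (X t) - f (X 0) -
      (partition_sum (P n) t (\<lambda>u v. g.kernel (X u) (X v)) - partition_sum (P n) t (\<lambda>u v. h.kernel (X u) (X v)))"
    if t: "t \<in> {0..T}" for n t
  proof -
    note D = refining_partitionsD(1)[OF P, of n]
    note p = partition_ofD[OF D]
    have "partition_sum (P n) t (\<lambda>u v. g.kernel (X u) (X v)) - partition_sum (P n) t (\<lambda>u v. h.kernel (X u) (X v)) =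
      (\<Sum>(u, v)\<in>steps (P n). g.kernel (X (min u t)) (X (min v t)) - h.kernel (X (min u t)) (X (min v t)))"
      by (simp add: partition_sum_min p(1) g.kernel_refl h.kernel_refl case_prod_beta sum_subtractf)
    also have "\<dots> = (\<Sum>(u, v)\<in>steps (P n). (f (X (min v t)) - f (X (min u t))) -
        f' (X (min u t)) * (X (min v t) - X (min u t)))"
    proof (rule sum.cong[OF refl], clarify)
      fix u v assume uv: "(u, v) \<in> steps (P n)"
      have uv': "0 \<le> min u t" "min u t \<le> T" "0 \<le> min v t" "min v t \<le> T"
        using p(4)[OF stepsD(1)[OF uv]] p(4)[OF stepsD(2)[OF uv]] t by auto
      show "g.kernel (X (min u t)) (X (min v t)) - h.kernel (X (min u t)) (X (min v t)) =
          (f (X (min v t)) - f (X (min u t))) - f' (X (min u t)) * (X (min v t) - X (min u t))"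
        by (rule tanaka_remainder[OF f gh, symmetric]) (use K uv' in auto)
    qed
    also have "\<dots> = f (X t) - f (X 0) - riemann_sum (P n) (\<lambda>s. f' (X s)) X t"
      using sum_steps_min[OF D, of t "\<lambda>s. f (X s)"] t
      by (simp add: riemann_sum_def partition_sum_min p(1) case_prod_beta sum_subtractf)
    finally show ?thesis by simp
  qed
  have "uniform_limit {0..T} (\<lambda>n t. f (X t) - f (X 0) -
      (partition_sum (P n) t (\<lambda>u v. g.kernel (X u) (X v)) - partition_sum (P n) t (\<lambda>u v. h.kernel (X u) (X v))))
      (\<lambda>t. f (X t) - f (X 0) - (\<Lambda>1 t - \<Lambda>2 t)) sequentially"
    by (intro uniform_limit_intros \<Lambda>1 \<Lambda>2)
  then have "uniform_limit {0..T} (\<lambda>n t. riemann_sum (P n) (\<lambda>s. f' (X s)) X t)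
      (\<lambda>t. f (X t) - f (X 0) - (\<Lambda>1 t - \<Lambda>2 t)) sequentially"
    by (rule uniform_limit_cong'[THEN iffD1, rotated -1]) (auto simp: eq)
  then show thesis
    using that \<Lambda>1 \<Lambda>2 by blast
qed

section \<open>Uniform limits of Riemann sums against X + A\<close>

lemma continuous_on_dominated:
  fixes F W :: "real \<Rightarrow> real"
  assumes W: "continuous_on {a..b} W"
    and le: "\<And>x y. a \<le> x \<Longrightarrow> x \<le> y \<Longrightarrow> y \<le> b \<Longrightarrow> \<bar>F y - F x\<bar> \<le> W y - W x"
  shows "continuous_on {a..b} F"
  unfolding continuous_on_iff
proof (intro ballI allI impI)
  fix x and e :: real assume x: "x \<in> {a..b}" and "e > 0"
  then obtain d where d: "d > 0" "\<And>y. y \<in> {a..b} \<Longrightarrow> dist y x < d \<Longrightarrow> dist (W y) (W x) < e"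
    using W unfolding continuous_on_iff by blast
  have "dist (F y) (F x) \<le> dist (W y) (W x)" if "y \<in> {a..b}" for y
    using le[of x y] le[of y x] x that by (cases "x \<le> y") (auto simp: dist_real_def abs_if split: if_splits)
  then show "\<exists>d>0. \<forall>y\<in>{a..b}. dist y x < d \<longrightarrow> dist (F y) (F x) < e"
    using d by (meson le_less_trans)
qed

text \<open>\<open>B * W\<close> controls the increments of every sum and hence of the limit. This
  makes the limit continuous and allows the assumed pointwise convergence to be upgraded.\<close>

lemma riemann_sums_dominated_uniform_limit:
  assumes P: "refining_partitions T P"
    and h: "\<And>s. 0 \<le> s \<Longrightarrow> s \<le> T \<Longrightarrow> \<bar>h s\<bar> \<le> B" and B: "0 \<le> B"
    and Y: "\<And>a b. 0 \<le> a \<Longrightarrow> a \<le> b \<Longrightarrow> b \<le> T \<Longrightarrow> \<bar>Y b - Y a\<bar> \<le> W b - W a"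
    and W: "continuous_on {0..T} W"
    and conv: "\<And>t. t \<in> {0..T} \<Longrightarrow> convergent (\<lambda>n. riemann_sum (P n) h Y t)"
  obtains N where "\<And>a b. 0 \<le> a \<Longrightarrow> a \<le> b \<Longrightarrow> b \<le> T \<Longrightarrow> \<bar>N b - N a\<bar> \<le> B * W b - B * W a"
    and "uniform_limit {0..T} (\<lambda>n t. riemann_sum (P n) h Y t) N sequentially"
proof
  define N where "N t = lim (\<lambda>n. riemann_sum (P n) h Y t)" for t
  have lim: "(\<lambda>n. riemann_sum (P n) h Y t) \<longlonglongrightarrow> N t" if "t \<in> {0..T}" for t
    using conv[OF that] by (simp add: N_def convergent_LIMSEQ_iff)
  have Lip: "\<bar>riemann_sum (P n) h Y b - riemann_sum (P n) h Y a\<bar> \<le> B * W b - B * W a"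
    if "0 \<le> a" "a \<le> b" "b \<le> T" for n a b
    using riemann_sum_Lipschitz[OF refining_partitionsD(1)[OF P] that _ Y, of n h B]
      partition_ofD(4)[OF refining_partitionsD(1)[OF P]] h
    by (auto simp: algebra_simps)
  show N: "\<bar>N b - N a\<bar> \<le> B * W b - B * W a" if "0 \<le> a" "a \<le> b" "b \<le> T" for a b
    using that by (intro LIMSEQ_le_const2[OF tendsto_rabs[OF tendsto_diff[OF lim lim]]] exI allI impI Lip) auto
  have BW: "continuous_on {0..T} (\<lambda>t. B * W t)"
    by (intro continuous_intros W)
  \<comment> \<open>Adding \<open>B * W\<close> makes the sums monotone in \<open>t\<close>.\<close>
  have "uniform_limit {0..T} (\<lambda>n t. riemann_sum (P n) h Y t + B * W t) (\<lambda>t. N t + B * W t) sequentially"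
  proof (rule uniform_limit_almost_monotone)
    show "continuous_on {0..T} (\<lambda>t. N t + B * W t)"
      by (intro continuous_intros BW continuous_on_dominated[OF BW N])
    show "(\<lambda>n. riemann_sum (P n) h Y t + B * W t) \<longlonglongrightarrow> N t + B * W t" if "t \<in> {0..T}" for t
      by (intro tendsto_intros lim that)
    show "\<forall>\<^sub>F n in sequentially. \<forall>s t. 0 \<le> s \<longrightarrow> s \<le> t \<longrightarrow> t \<le> T \<longrightarrow>
        riemann_sum (P n) h Y s + B * W s \<le> riemann_sum (P n) h Y t + B * W t + \<epsilon>" if "\<epsilon> > 0" for \<epsilon>
    proof (intro always_eventually allI impI)
      fix n s t assume "0 \<le> s" "s \<le> t" "t \<le> T"
      then show "riemann_sum (P n) h Y s + B * W s \<le> riemann_sum (P n) h Y t + B * W t + \<epsilon>"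
        using Lip[of s t n] \<open>\<epsilon> > 0\<close> by linarith
    qed
  qed
  from uniform_limit_add[OF this uniform_limit_const[where c = "\<lambda>t. - (B * W t)"]]
  show "uniform_limit {0..T} (\<lambda>n t. riemann_sum (P n) h Y t) N sequentially"
    by (rule uniform_limit_cong'[THEN iffD1, rotated -1]) auto
qed

lemma density_bounded:
  fixes f' :: "real \<Rightarrow> real"
  assumes "bounded_variation f' l r" "l \<le> x" "x \<le> r"
  shows "\<bar>f' x\<bar> \<le> \<bar>f' l\<bar> + total_variation f' l r"
proof -
  have bv: "bounded_variation f' l x"
    using assms by (intro bounded_variation_subinterval[OF assms(1)]) auto
  have "\<bar>f' x - f' l\<bar> \<le> total_variation f' l x"
    using norm_diff_le_total_variation[OF bv] assms by simp
  moreover have "total_variation f' l x \<le> total_variation f' l r"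
    using total_variation_increment(1)[OF assms order_refl] norm_ge_zero[of "f' r - f' x"] by linarith
  ultimately show ?thesis by linarith
qed

text \<open>A density of bounded variation is bounded on \<open>[l, r]\<close>, so \<open>f\<close>
  is Lipschitz there.\<close>

lemma absolutely_continuous_imp_continuous_on:
  assumes f: "absolutely_continuous_with_density f f'" and bv: "bounded_variation f' l r"
  shows "continuous_on {l..r} f"
proof -
  define B where "B = \<bar>f' l\<bar> + total_variation f' l r"
  show ?thesis
  proof (rule continuous_on_dominated[where W = "\<lambda>x. B * x"])
    show "\<bar>f y - f x\<bar> \<le> B * y - B * x" if xy: "l \<le> x" "x \<le> y" "y \<le> r" for x y
    proof -
      have f': "set_integrable lborel {x..y} f'" "f y - f x = (LINT z:{x..y}|lborel. f' z)"
        using f xy by (auto simp: absolutely_continuous_with_density_def)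
      have const: "set_integrable lborel {x..y} (\<lambda>_. c)" "(LINT z:{x..y}|lborel. c) = c * (y - x)"
        for c :: real
        using xy by (auto intro!: borel_integrable_atLeastAtMost' simp: set_integral_const)
      have B: "f' z \<le> B" "- B \<le> f' z" if "z \<in> {x..y}" for z
        using density_bounded[OF bv, of z] that xy by (auto simp: B_def abs_le_iff)
      have "(LINT z:{x..y}|lborel. f' z) \<le> B * (y - x)"
        unfolding const(2)[symmetric] by (intro set_integral_mono f' const B)
      moreover have "- B * (y - x) \<le> (LINT z:{x..y}|lborel. f' z)"
        unfolding const(2)[symmetric] by (intro set_integral_mono f' const B)
      ultimately show ?thesis
        unfolding f'(2) by (simp add: abs_le_iff algebra_simps)
    qed
  qed (intro continuous_intros)
qed

lemma continuous_on_comp_density: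
  fixes X :: "real \<Rightarrow> real"
  assumes f: "absolutely_continuous_with_density f f'" and bv: "\<And>a b. bounded_variation f' a b"
    and X: "continuous_on {0..T} X"
  shows "continuous_on {0..T} (\<lambda>t. f (X t))" and "\<exists>B\<ge>0. \<forall>s\<in>{0..T}. \<bar>f' (X s)\<bar> \<le> B"
proof -
  obtain B where B: "\<forall>s\<in>{0..T}. \<bar>X s\<bar> \<le> B"
    using continuous_on_Icc_bounded[OF X] by blast
  have XB: "X s \<in> {- B..B}" if "s \<in> {0..T}" for s
    using bspec[OF B that] by (auto simp: abs_le_iff)
  show "continuous_on {0..T} (\<lambda>t. f (X t))"
    using XB by (intro continuous_on_compose2[OF absolutely_continuous_imp_continuous_on[OF f bv[of "- B" B]] X]) auto
  have "\<bar>f' (X s)\<bar> \<le> \<bar>\<bar>f' (- B)\<bar> + total_variation f' (- B) B\<bar>" if "s \<in> {0..T}" for s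
    using density_bounded[OF bv, of "- B" "X s" B] XB[OF that] by auto
  then show "\<exists>B\<ge>0. \<forall>s\<in>{0..T}. \<bar>f' (X s)\<bar> \<le> B"
    by (intro exI[of _ "\<bar>\<bar>f' (- B)\<bar> + total_variation f' (- B) B\<bar>"]) auto
qed

lemma riemann_sum_add_integrator:
  "finite D \<Longrightarrow> riemann_sum D h (\<lambda>s. Y s + Z s) t = riemann_sum D h Y t + riemann_sum D h Z t"
  by (simp add: riemann_sum_min case_prod_beta algebra_simps flip: sum.distrib)

lemma riemann_sum_diff_integrator:
  "finite D \<Longrightarrow> riemann_sum D h (\<lambda>s. Y s - Z s) t = riemann_sum D h Y t - riemann_sum D h Z t"
  by (simp add: riemann_sum_min case_prod_beta algebra_simps flip: sum_subtractf)

text \<open>The sums against \<open>X\<close> are treated by the Tanaka formula and those against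
  \<open>A\<close> by domination. Everything except the increment of \<open>f\<close> is collected
  in \<open>\<Gamma>\<close>, with control function \<open>U\<close>. Since \<open>f' (X s)\<close>
  may jump as \<open>s\<close> varies, convergence of the sums against \<open>A\<close> is a
  hypothesis.\<close>

lemma local_time_plus_bv_riemann_sums_uniform_limit:
  assumes P: "refining_partitions T P" and X: "has_continuous_local_time P T X"
    and f: "absolutely_continuous_with_density f f'"
    and f'_right: "\<And>x. continuous (at_right x) f'" and f'_bv: "\<And>a b. bounded_variation f' a b"
    and A: "\<And>a b. 0 \<le> a \<Longrightarrow> a \<le> b \<Longrightarrow> b \<le> T \<Longrightarrow> \<bar>A b - A a\<bar> \<le> W b - W a"
    and W: "continuous_on {0..T} W"
    and conv: "\<And>t. t \<in> {0..T} \<Longrightarrow> convergent (\<lambda>n. riemann_sum (P n) (\<lambda>s. f' (X s)) A t)"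
  shows "\<exists>\<Gamma> U. continuous_on {0..T} U \<and>
    (\<forall>a b. 0 \<le> a \<longrightarrow> a \<le> b \<longrightarrow> b \<le> T \<longrightarrow> \<bar>\<Gamma> b - \<Gamma> a\<bar> \<le> U b - U a) \<and>
    uniform_limit {0..T} (\<lambda>n t. riemann_sum (P n) (\<lambda>s. f' (X s)) (\<lambda>s. X s + A s) t)
      (\<lambda>t. f (X t) - f (X 0) + \<Gamma> t) sequentially"
proof -
  have X_cont: "continuous_on {0..T} X"
    using X by (simp add: has_continuous_local_time_def)
  obtain B where B: "0 \<le> B" "\<forall>s\<in>{0..T}. \<bar>f' (X s)\<bar> \<le> B"
    using continuous_on_comp_density(2)[OF f f'_bv X_cont] by blast
  obtain N where N: "\<And>a b. 0 \<le> a \<Longrightarrow> a \<le> b \<Longrightarrow> b \<le> T \<Longrightarrow> \<bar>N b - N a\<bar> \<le> B * W b - B * W a"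
    "uniform_limit {0..T} (\<lambda>n t. riemann_sum (P n) (\<lambda>s. f' (X s)) A t) N sequentially"
  proof (rule riemann_sums_dominated_uniform_limit[OF P _ B(1) A W conv])
    show "\<bar>f' (X s)\<bar> \<le> B" if "0 \<le> s" "s \<le> T" for s
      using B(2) that by auto
  qed blast+
  obtain \<Lambda>1 \<Lambda>2 where \<Lambda>: "continuous_on {0..T} \<Lambda>1" "continuous_on {0..T} \<Lambda>2"
    "\<And>s t. 0 \<le> s \<Longrightarrow> s \<le> t \<Longrightarrow> t \<le> T \<Longrightarrow> \<Lambda>1 s \<le> \<Lambda>1 t"
    "\<And>s t. 0 \<le> s \<Longrightarrow> s \<le> t \<Longrightarrow> t \<le> T \<Longrightarrow> \<Lambda>2 s \<le> \<Lambda>2 t"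
    "uniform_limit {0..T} (\<lambda>n t. riemann_sum (P n) (\<lambda>s. f' (X s)) X t)
      (\<lambda>t. f (X t) - f (X 0) - (\<Lambda>1 t - \<Lambda>2 t)) sequentially"
    using pathwise_tanaka[OF P X f f'_right f'_bv] by blast
  show ?thesis
  proof (intro exI conjI allI impI)
    show "continuous_on {0..T} (\<lambda>t. \<Lambda>1 t + \<Lambda>2 t + B * W t)"
      by (intro continuous_intros \<Lambda> W)
    show "\<bar>(N b - (\<Lambda>1 b - \<Lambda>2 b)) - (N a - (\<Lambda>1 a - \<Lambda>2 a))\<bar> \<le>
        (\<Lambda>1 b + \<Lambda>2 b + B * W b) - (\<Lambda>1 a + \<Lambda>2 a + B * W a)" if "0 \<le> a" "a \<le> b" "b \<le> T" for a b
      using N(1)[OF that] \<Lambda>(3)[OF that] \<Lambda>(4)[OF that] unfolding abs_le_iff by linarith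
    show "uniform_limit {0..T} (\<lambda>n t. riemann_sum (P n) (\<lambda>s. f' (X s)) (\<lambda>s. X s + A s) t)
      (\<lambda>t. f (X t) - f (X 0) + (N t - (\<Lambda>1 t - \<Lambda>2 t))) sequentially"
      using uniform_limit_add[OF \<Lambda>(5) N(2)]
      by (rule uniform_limit_cong'[THEN iffD1, rotated -1])
        (auto simp: riemann_sum_add_integrator[OF partition_ofD(1)[OF refining_partitionsD(1)[OF P]]])
  qed
qed

lemma uniform_limit_sum:
  fixes F :: "'i \<Rightarrow> 'a \<Rightarrow> 'b \<Rightarrow> 'c::real_normed_vector"
  assumes "\<And>i. i \<in> I \<Longrightarrow> uniform_limit S (F i) (l i) net"
  shows "uniform_limit S (\<lambda>n x. \<Sum>i\<in>I. F i n x) (\<lambda>x. \<Sum>i\<in>I. l i x) net"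
  using assms
  by (induction I rule: infinite_finite_induct) (simp_all add: uniform_limit_add uniform_limit_const)

section \<open>Multiplicative generation\<close>

text \<open>Tangent bounds at \<open>x\<close> and at \<open>y\<close> from convexity; together they
  serve as a chain rule with explicit error.\<close>

lemma exp_increment_bounds:
  fixes x y :: real
  shows "exp x * (y - x) \<le> exp y - exp x" and "exp y - exp x \<le> exp y * (y - x)"
proof -
  have "exp x * (1 + (y - x)) \<le> exp x * exp (y - x)"
    by (intro mult_left_mono exp_ge_add_one_self) auto
  then show "exp x * (y - x) \<le> exp y - exp x"
    by (simp add: algebra_simps flip: exp_add)
  have "exp y * (1 + (x - y)) \<le> exp y * exp (x - y)"
    by (intro mult_left_mono exp_ge_add_one_self) auto
  then show "exp y - exp x \<le> exp y * (y - x)"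
    by (simp add: algebra_simps flip: exp_add)
qed

text \<open>The integrator \<open>M n\<close> is split into its limit and a uniformly small rest.
  The limit is handled by comparing increments with those of \<open>E * G\<close>, the rest by
  summation by parts.\<close>

lemma riemann_sums_exp_stieltjes_tendsto:
  fixes G \<Gamma> :: "real \<Rightarrow> real"
  defines "E \<equiv> \<lambda>t. exp (stieltjes_integral (\<lambda>s. 1 / G s) \<Gamma> t)"
  assumes P: "refining_partitions T P" and t: "0 \<le> t" "t \<le> T"
    and G: "continuous_on {0..T} G" and G_nz: "\<And>s. s \<in> {0..T} \<Longrightarrow> G s \<noteq> 0"
    and U: "continuous_on {0..T} U"
    and \<Gamma>_U: "\<And>a b. 0 \<le> a \<Longrightarrow> a \<le> b \<Longrightarrow> b \<le> T \<Longrightarrow> \<bar>\<Gamma> b - \<Gamma> a\<bar> \<le> U b - U a"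
    and M: "uniform_limit {0..T} M (\<lambda>t. G t - G 0 + \<Gamma> t) sequentially"
  shows "(\<lambda>n. riemann_sum (P n) E (M n) t) \<longlonglongrightarrow> E t * G t - E 0 * G 0"
proof -
  define Z where "Z = stieltjes_integral (\<lambda>s. 1 / G s) \<Gamma>"
  define V where "V = total_variation \<Gamma> 0"
  have E_eq: "E s = exp (Z s)" for s by (simp add: E_def Z_def)
  have T: "0 \<le> T" using t by simp
  have \<Gamma>: "continuous_on {0..T} \<Gamma>"
    by (rule continuous_on_dominated[OF U \<Gamma>_U])
  have bv: "bounded_variation \<Gamma> 0 T"
    using bounded_variation_dominated[OF T, of \<Gamma> U] \<Gamma>_U by simp
  have V: "continuous_on {0..T} V"
    unfolding V_def using \<Gamma> continuous_total_variation[OF bv, of _ "{0..T}"]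
    by (auto simp: continuous_on_eq_continuous_within)
  have \<Gamma>_V: "\<bar>\<Gamma> b - \<Gamma> a\<bar> \<le> V b - V a" if "0 \<le> a" "a \<le> b" "b \<le> T" for a b
    using total_variation_increment(1)[OF bv that] by (simp add: V_def)
  have V_mono: "V a \<le> V b" if "0 \<le> a" "a \<le> b" "b \<le> T" for a b
    using \<Gamma>_V[OF that] by linarith
  have g: "continuous_on {0..T} (\<lambda>s. 1 / G s)"
    using G_nz by (intro continuous_intros G) auto
  have Z: "\<bar>Z v - Z u - c * (\<Gamma> v - \<Gamma> u)\<bar> \<le> \<epsilon> * (V v - V u)"
    if "0 \<le> u" "u \<le> v" "v \<le> T" "\<And>s. u \<le> s \<Longrightarrow> s \<le> v \<Longrightarrow> \<bar>1 / G s - c\<bar> \<le> \<epsilon>" for u v c \<epsilon>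
    unfolding Z_def V_def using stieltjes_integral_increment[OF bv \<Gamma> that(1-3) g that(4)] by blast
  obtain Bg where Bg: "\<forall>s\<in>{0..T}. \<bar>1 / G s\<bar> \<le> Bg"
    using continuous_on_Icc_bounded[OF g] by blast
  obtain BG where BG: "\<forall>s\<in>{0..T}. \<bar>G s\<bar> \<le> BG"
    using continuous_on_Icc_bounded[OF G] by blast
  \<comment> \<open>The case \<open>c = 0\<close> of the local estimate.\<close>
  have Z_V: "\<bar>Z v - Z u\<bar> \<le> Bg * V v - Bg * V u" if "0 \<le> u" "u \<le> v" "v \<le> T" for u v
    using Z[OF that, of 0 Bg] Bg that by (simp add: algebra_simps)
  have Z_cont: "continuous_on {0..T} Z"
    by (rule continuous_on_dominated[OF _ Z_V]) (intro continuous_intros V)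
  have E_cont: "continuous_on {0..T} E"
    unfolding E_eq[abs_def] by (intro continuous_intros Z_cont)
  obtain BE where BE: "\<forall>s\<in>{0..T}. \<bar>E s\<bar> \<le> BE"
    using continuous_on_Icc_bounded[OF E_cont] by blast
  have pos: "0 \<le> Bg" "0 \<le> BG" "0 \<le> BE"
    using T by (auto intro: order_trans[OF abs_ge_zero bspec[OF Bg, of 0]]
      order_trans[OF abs_ge_zero bspec[OF BG, of 0]] order_trans[OF abs_ge_zero bspec[OF BE, of 0]])
  have E_bd: "0 < E s" "0 \<le> s \<Longrightarrow> s \<le> T \<Longrightarrow> E s \<le> BE" for s
    using BE by (auto simp: E_eq)
  \<comment> \<open>The tangent bound is used at the end point with the larger exponent, where
    \<open>E\<close> is at most \<open>BE\<close>.\<close>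
  have E_V: "\<bar>E v - E u\<bar> \<le> BE * Bg * V v - BE * Bg * V u" if "0 \<le> u" "u \<le> v" "v \<le> T" for u v
  proof -
    have "\<bar>E v - E u\<bar> \<le> BE * \<bar>Z v - Z u\<bar>"
    proof (cases "Z u \<le> Z v")
      case True
      have "E v - E u \<le> E v * (Z v - Z u)" "E u * (Z v - Z u) \<le> E v - E u"
        using exp_increment_bounds[where x = "Z u" and y = "Z v"] by (auto simp: E_eq)
      moreover have "E v * (Z v - Z u) \<le> BE * (Z v - Z u)"
        using True E_bd that by (intro mult_right_mono) auto
      moreover have "0 \<le> E u * (Z v - Z u)"
        using True E_bd(1)[of u] by simp
      ultimately show ?thesis using True by (simp add: abs_of_nonneg)
    next
      case False
      have "E u - E v \<le> E u * (Z u - Z v)" "E v * (Z u - Z v) \<le> E u - E v"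
        using exp_increment_bounds[where x = "Z v" and y = "Z u"] by (auto simp: E_eq)
      moreover have "E u * (Z u - Z v) \<le> BE * (Z u - Z v)"
        using False E_bd that by (intro mult_right_mono) auto
      moreover have "0 \<le> E v * (Z u - Z v)"
        using False E_bd(1)[of v] by simp
      ultimately have "0 \<le> E u - E v" "E u - E v \<le> BE * (Z u - Z v)" by linarith+
      moreover have "\<bar>Z v - Z u\<bar> = Z u - Z v" using False by simp
      ultimately show ?thesis by simp
    qed
    also have "\<dots> \<le> BE * (Bg * V v - Bg * V u)"
      using Z_V[OF that] pos by (intro mult_left_mono) auto
    finally show ?thesis by (simp add: algebra_simps)
  qed
  define M' where "M' = (\<lambda>t. G t - G 0 + \<Gamma> t)"
  have 1: "(\<lambda>n. riemann_sum (P n) E M' t) \<longlonglongrightarrow> E t * G t - E 0 * G 0"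
  proof (rule riemann_sum_tendsto_by_increments[OF P t V_mono, where F = "\<lambda>s. E s * G s"])
    fix \<epsilon> :: real assume \<epsilon>: "\<epsilon> > 0"
    \<comment> \<open>\<open>BE * BG\<close> comes from approximating \<open>dZ\<close> by
      \<open>d\<Gamma> / G\<close>, \<open>BG * Bg\<close> from linearising the exponential; the
      added 1 keeps the denominator positive.\<close>
    define \<kappa> where "\<kappa> = \<epsilon> / (BE * BG + BG * Bg + 1)"
    have den: "0 < BE * BG + BG * Bg + 1"
      using pos by (intro add_nonneg_pos add_nonneg_nonneg mult_nonneg_nonneg) auto
    have \<kappa>: "\<kappa> > 0" "(BE * BG + BG * Bg) * \<kappa> \<le> \<epsilon>"
      using den \<epsilon> by (auto simp: \<kappa>_def field_simps)
    have "uniformly_continuous_on {0..T} (\<lambda>s. 1 / G s)" "uniformly_continuous_on {0..T} E"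
      using g E_cont by (auto intro!: compact_uniformly_continuous)
    then obtain d1 d2 where d: "d1 > 0" "d2 > 0"
      "\<And>x y. x \<in> {0..T} \<Longrightarrow> y \<in> {0..T} \<Longrightarrow> dist y x < d1 \<Longrightarrow> dist (1 / G y) (1 / G x) < \<kappa>"
      "\<And>x y. x \<in> {0..T} \<Longrightarrow> y \<in> {0..T} \<Longrightarrow> dist y x < d2 \<Longrightarrow> dist (E y) (E x) < \<kappa>"
      unfolding uniformly_continuous_on_def using \<kappa>(1) by metis
    show "\<exists>\<delta>>0. \<forall>u v. 0 \<le> u \<longrightarrow> u \<le> v \<longrightarrow> v \<le> T \<longrightarrow> v - u < \<delta> \<longrightarrow>
       \<bar>E u * (M' v - M' u) - (E v * G v - E u * G u)\<bar> \<le> \<epsilon> * (V v - V u)"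
    proof (intro exI[of _ "min d1 d2"] conjI allI impI)
      fix u v assume uv: "0 \<le> u" "u \<le> v" "v \<le> T" "v - u < min d1 d2"
      \<comment> \<open>The error is \<open>E u * ?g - G v * ?e\<close>, which is small because \<open>G dE = E G dZ = E d\<Gamma>\<close>.\<close>
      let ?z = "Z v - Z u" and ?e = "E v - E u" and ?g = "\<Gamma> v - \<Gamma> u"
      \<comment> \<open>The reference value is taken at the right end point because the product rule
        leaves \<open>G v\<close> in front of \<open>?e\<close>.\<close>
      have "\<bar>?z - 1 / G v * ?g\<bar> \<le> \<kappa> * (V v - V u)"
      proof (rule Z[OF uv(1-3)])
        show "\<bar>1 / G s - 1 / G v\<bar> \<le> \<kappa>" if "u \<le> s" "s \<le> v" for s
          using d(3)[of v s] that uv by (auto simp: dist_real_def)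
      qed
      then have a: "\<bar>E u\<bar> * \<bar>G v\<bar> * \<bar>1 / G v * ?g - ?z\<bar> \<le> BE * BG * (\<kappa> * (V v - V u))"
        using pos BE BG uv by (intro mult_mono) (auto simp: abs_minus_commute)
      \<comment> \<open>The tangent bounds confine the linearisation error between 0 and a product
        of two increments; one is controlled by \<open>V\<close>, the other is below
        \<open>\<kappa>\<close>.\<close>
      have e: "0 \<le> ?e - E u * ?z" "?e - E u * ?z \<le> ?z * ?e"
        using exp_increment_bounds[where x = "Z u" and y = "Z v"] by (auto simp: E_eq algebra_simps)
      have "\<bar>?e - E u * ?z\<bar> \<le> \<bar>?z\<bar> * \<bar>?e\<bar>"
        using e unfolding abs_mult[symmetric] by linarith
      also have "\<dots> \<le> (Bg * V v - Bg * V u) * \<kappa>"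
        using Z_V[OF uv(1-3)] d(4)[of u v] uv by (intro mult_mono) (auto simp: dist_real_def)
      finally have "\<bar>G v\<bar> * \<bar>?e - E u * ?z\<bar> \<le> BG * ((Bg * V v - Bg * V u) * \<kappa>)"
        using pos BG uv by (intro mult_mono) auto
      moreover have "E u * (M' v - M' u) - (E v * G v - E u * G u) =
          E u * G v * (1 / G v * ?g - ?z) - G v * (?e - E u * ?z)"
        using G_nz[of v] uv by (simp add: M'_def field_simps)
      ultimately have "\<bar>E u * (M' v - M' u) - (E v * G v - E u * G u)\<bar> \<le>
          BE * BG * (\<kappa> * (V v - V u)) + BG * ((Bg * V v - Bg * V u) * \<kappa>)"
        using a by (simp only: abs_mult[symmetric])
      also have "\<dots> = (BE * BG + BG * Bg) * \<kappa> * (V v - V u)"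
        by (simp add: algebra_simps)
      also have "\<dots> \<le> \<epsilon> * (V v - V u)"
        using \<kappa>(2) V_mono[OF uv(1-3)] by (intro mult_right_mono) auto
      finally show "\<bar>E u * (M' v - M' u) - (E v * G v - E u * G u)\<bar> \<le> \<epsilon> * (V v - V u)" .
    qed (use d in simp)
  qed
  have 2: "(\<lambda>n. riemann_sum (P n) E (\<lambda>s. M n s - M' s) t) \<longlonglongrightarrow> 0"
  proof (rule tendstoI)
    fix e :: real assume e: "e > 0"
    \<comment> \<open>The constant of \<open>riemann_sum_small_integrator\<close> when
      \<open>BE * Bg * V\<close> controls \<open>E\<close>.\<close>
    define C where "C = 2 * BE + (BE * Bg * V t - BE * Bg * V 0)"
    have "0 \<le> BE * Bg * V t - BE * Bg * V 0"
      using V_mono[of 0 t] t pos by (simp add: mult_left_mono)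
    then have C: "0 \<le> C" using pos by (simp add: C_def)
    have "\<forall>\<^sub>F n in sequentially. \<forall>s\<in>{0..T}. dist (M n s) (M' s) < e / (C + 1)"
      using M e C unfolding M'_def by (intro uniform_limitD) auto
    then show "\<forall>\<^sub>F n in sequentially. dist (riemann_sum (P n) E (\<lambda>s. M n s - M' s) t) 0 < e"
    proof eventually_elim
      case (elim n)
      have "\<bar>riemann_sum (P n) E (\<lambda>s. M n s - M' s) t\<bar> \<le> e / (C + 1) * C"
        unfolding C_def
      proof (rule riemann_sum_small_integrator[OF refining_partitionsD(1)[OF P] t])
        show "\<bar>M n s - M' s\<bar> \<le> e / (2 * BE + (BE * Bg * V t - BE * Bg * V 0) + 1)" if "0 \<le> s" "s \<le> T" for s
          using elim that by (auto simp: dist_real_def C_def intro: less_imp_le)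
        show "\<bar>E s\<bar> \<le> BE" if "0 \<le> s" "s \<le> T" for s
          using BE that by auto
      qed (rule E_V)
      also have "\<dots> < e" using e C by (simp add: field_simps)
      finally show ?case by simp
    qed
  qed
  have "riemann_sum (P n) E (M n) t = riemann_sum (P n) E (\<lambda>s. M n s - M' s) t + riemann_sum (P n) E M' t" for n
    using partition_ofD(1)[OF refining_partitionsD(1)[OF P]] by (simp add: riemann_sum_diff_integrator)
  then show ?thesis
    using tendsto_add[OF 2 1] by simp
qed

section \<open>Value and positions of the generated strategy\<close>

theorem proposition5p12:
  fixes T :: real
    and P :: "nat \<Rightarrow> real set"
    and S \<mu> A X \<theta> \<psi> :: "real \<Rightarrow> real ^ 'd"
    and f f' :: "'d \<Rightarrow> real \<Rightarrow> real"
    and G :: "real ^ 'd \<Rightarrow> real ^ 'd \<Rightarrow> real"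
    and V :: "real \<Rightarrow> real"
  assumes T_pos: "0 < T"
    and partitions: "refining_partitions T P"
    and dim: "2 \<le> CARD('d)"
    and S_cont: "continuous_on {0..T} S"
    and S_nonneg: "\<forall>t\<in>{0..T}. \<forall>i. 0 \<le> S t $ i"
    and S_init: "\<forall>i. 0 < S 0 $ i"
    and S_total: "\<forall>t\<in>{0..T}. 0 < (\<Sum>j\<in>UNIV. S t $ j)"
    and mu_eq: "\<mu> = (\<lambda>t. \<chi> i. S t $ i / (\<Sum>j\<in>UNIV. S t $ j))"
    and mu_quadratic_variation: "\<forall>i. has_quadratic_variation P T (\<lambda>t. \<mu> t $ i)"
    and A_CBV: "A \<in> CBV T"
    and X_eq: "X = (\<lambda>t. \<mu> t - A t)"
    and mu_local_time: "\<forall>i. has_continuous_local_time P T (\<lambda>t. \<mu> t $ i)"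
    and X_local_time: "\<forall>i. has_continuous_local_time P T (\<lambda>t. X t $ i)"
    and f_abs_cont: "\<forall>i. absolutely_continuous_with_density (f i) (f' i)"
    and f'_right_cont: "\<forall>i x. continuous (at_right x) (f' i)"
    and f'_finite_variation: "\<forall>i a b. bounded_variation (f' i) a b"
    and G_eq: "G = (\<lambda>m a. \<Sum>i\<in>UNIV. f i (m $ i - a $ i))"
    and theta_eq: "\<theta> = (\<lambda>t. \<chi> i. f' i (X t $ i))"
    and integrals_exist:
      "\<forall>i. \<forall>t\<in>{0..T}. convergent (\<lambda>n. riemann_sum (P n) (\<lambda>s. \<theta> s $ i) (\<lambda>s. A s $ i) t)"
    and G_nonzero: "\<forall>t\<in>{0..T}. G (\<mu> t) (A t) \<noteq> 0"
    and G_inverse_bounded: "locally_bounded_on {0..T} (\<lambda>t. 1 / G (\<mu> t) (A t))"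
    and G_init_pos: "0 < G (\<mu> 0) (A 0)"
    and psi_eq: "\<psi> = multiplicatively_generated P G \<theta> \<mu> A"
    and V_eq: "V = (\<lambda>t. \<Sum>i\<in>UNIV. \<psi> t $ i * \<mu> t $ i)"
  shows "(\<forall>t\<in>{0..T}.
            V t = G (\<mu> t) (A t) *
              exp (stieltjes_integral (\<lambda>s. 1 / G (\<mu> s) (A s)) (gamma_process P G \<theta> \<mu> A) t) \<and>
            G (\<mu> t) (A t) *
              exp (stieltjes_integral (\<lambda>s. 1 / G (\<mu> s) (A s)) (gamma_process P G \<theta> \<mu> A) t) > 0) \<and>
         (\<forall>i. \<forall>t\<in>{0..T}.
            \<psi> t $ i =
              V t * (1 + 1 / G (\<mu> t) (A t) * (\<theta> t $ i - (\<Sum>j\<in>UNIV. \<theta> t $ j * \<mu> t $ j))))"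
proof -
  define \<gamma> where "\<gamma> = (\<lambda>t. G (\<mu> t) (A t))"
  define \<Gamma> where "\<Gamma> = gamma_process P G \<theta> \<mu> A"
  define E where "E = exponential_factor P G \<theta> \<mu> A"
  define M where "M = (\<lambda>n t. \<Sum>i\<in>UNIV. riemann_sum (P n) (\<lambda>s. \<theta> s $ i) (\<lambda>s. \<mu> s $ i) t)"
  define W where "W = total_variation A 0"
  note fin = partition_ofD(1)[OF refining_partitionsD(1)[OF partitions]]
  have E_eq: "E t = exp (stieltjes_integral (\<lambda>s. 1 / \<gamma> s) \<Gamma> t)" for t
    by (simp add: E_def \<gamma>_def \<Gamma>_def exponential_factor_def)
  have E_0: "E 0 = 1"
    by (simp add: E_eq stieltjes_integral_0)
  have \<gamma>_eq: "\<gamma> t = (\<Sum>i\<in>UNIV. f i (X t $ i))" for t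
    by (simp add: \<gamma>_def G_eq X_eq)
  have A_bv: "bounded_variation A 0 T" and A_cont: "continuous_on {0..T} A"
    using A_CBV by (auto simp: CBV_def)
  have W_cont: "continuous_on {0..T} W"
    unfolding W_def using A_cont continuous_total_variation[OF A_bv, of _ "{0..T}"]
    by (auto simp: continuous_on_eq_continuous_within)
  \<comment> \<open>The total variation of the vector-valued path controls all coordinates at
    once.\<close>
  have A_W: "\<bar>A b $ i - A a $ i\<bar> \<le> W b - W a" if "0 \<le> a" "a \<le> b" "b \<le> T" for a b i
    using order_trans[OF Finite_Cartesian_Product.norm_nth_le[of "A b - A a" i] total_variation_increment(1)[OF A_bv that]]
    by (simp add: W_def)
  have X_cont: "continuous_on {0..T} (\<lambda>t. X t $ i)" for i
    using X_local_time by (auto simp: has_continuous_local_time_def)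
  have \<gamma>_cont: "continuous_on {0..T} \<gamma>"
    unfolding \<gamma>_eq[abs_def]
    by (intro continuous_on_sum
        continuous_on_comp_density(1)[OF f_abs_cont[rule_format] f'_finite_variation[rule_format] X_cont])
  have \<gamma>_nz: "\<gamma> s \<noteq> 0" if "s \<in> {0..T}" for s
    using G_nonzero that by (auto simp: \<gamma>_def)
  \<comment> \<open>A continuous function that is positive at time 0 cannot cease to be positive
    without a zero.\<close>
  have \<gamma>_pos: "0 < \<gamma> t" if t: "t \<in> {0..T}" for t
  proof (rule ccontr)
    assume "\<not> 0 < \<gamma> t"
    then have "\<exists>x\<ge>0. x \<le> t \<and> \<gamma> x = 0"
      using G_init_pos t continuous_on_subset[OF \<gamma>_cont, of "{0..t}"]
      by (intro IVT2') (auto simp: \<gamma>_def)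
    then show False using \<gamma>_nz t by force
  qed
  \<comment> \<open>Bundles the three properties so that \<open>C\<close> and \<open>U\<close> can
    be chosen together for all coordinates.\<close>
  define Q where "Q i C U \<longleftrightarrow> continuous_on {0..T} U \<and>
    (\<forall>a b. 0 \<le> a \<longrightarrow> a \<le> b \<longrightarrow> b \<le> T \<longrightarrow> \<bar>C b - C a\<bar> \<le> U b - U a) \<and>
    uniform_limit {0..T} (\<lambda>n t. riemann_sum (P n) (\<lambda>s. \<theta> s $ i) (\<lambda>s. \<mu> s $ i) t)
      (\<lambda>t. f i (X t $ i) - f i (X 0 $ i) + C t) sequentially" for i C U
  have "\<exists>C U. Q i C U" for i
    using local_time_plus_bv_riemann_sums_uniform_limit[OF partitions X_local_time[rule_format, of i]
      f_abs_cont[rule_format, of i] f'_right_cont[rule_format, of _ i] f'_finite_variation[rule_format, of i]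
      A_W[of _ _ i] W_cont]
      integrals_exist[rule_format, of _ i]
    unfolding Q_def by (simp add: theta_eq X_eq)
  then obtain C U where CU: "\<And>i. Q i (C i) (U i)"
    by metis
  then have U: "continuous_on {0..T} (U i)"
    and C: "0 \<le> a \<Longrightarrow> a \<le> b \<Longrightarrow> b \<le> T \<Longrightarrow> \<bar>C i b - C i a\<bar> \<le> U i b - U i a"
    and lim: "uniform_limit {0..T} (\<lambda>n t. riemann_sum (P n) (\<lambda>s. \<theta> s $ i) (\<lambda>s. \<mu> s $ i) t)
      (\<lambda>t. f i (X t $ i) - f i (X 0 $ i) + C i t) sequentially" for i a b
    by (auto simp: Q_def)
  \<comment> \<open>The increments of the \<open>f i\<close> add up to the increment of
    \<open>\<gamma>\<close>, which the definition of \<open>\<Gamma>\<close> subtracts; only the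
    remainders \<open>C i\<close> are left, and these have control functions.\<close>
  have \<Gamma>_C: "\<Gamma> t = (\<Sum>i\<in>UNIV. C i t)" if t: "t \<in> {0..T}" for t
  proof -
    have "pathwise_integral P (\<lambda>s. \<theta> s $ i) (\<lambda>s. \<mu> s $ i) t = f i (X t $ i) - f i (X 0 $ i) + C i t" for i
      unfolding pathwise_integral_def by (intro limI tendsto_uniform_limitI[OF lim t])
    then show ?thesis
      by (simp add: \<Gamma>_def gamma_process_def \<gamma>_eq[unfolded \<gamma>_def] sum.distrib sum_subtractf)
  qed
  have \<Gamma>_U: "\<bar>\<Gamma> b - \<Gamma> a\<bar> \<le> (\<Sum>i\<in>UNIV. U i b) - (\<Sum>i\<in>UNIV. U i a)" if "0 \<le> a" "a \<le> b" "b \<le> T" for a b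
    using that by (auto simp: \<Gamma>_C simp flip: sum_subtractf intro!: order_trans[OF sum_abs] sum_mono C)
  have "uniform_limit {0..T} M (\<lambda>t. \<Sum>i\<in>UNIV. f i (X t $ i) - f i (X 0 $ i) + C i t) sequentially"
    unfolding M_def by (intro uniform_limit_sum lim)
  then have M_lim: "uniform_limit {0..T} M (\<lambda>t. \<gamma> t - \<gamma> 0 + \<Gamma> t) sequentially"
    by (rule uniform_limit_cong'[THEN iffD1, rotated -1])
      (auto simp: \<gamma>_eq \<Gamma>_C sum.distrib sum_subtractf)
  have integral: "pathwise_integral_vec P (\<lambda>s. E s *\<^sub>R \<theta> s) \<mu> t = E t * \<gamma> t - \<gamma> 0" if t: "t \<in> {0..T}" for t
  proof -
    have "(\<Sum>i\<in>UNIV. riemann_sum (P n) (\<lambda>s. (E s *\<^sub>R \<theta> s) $ i) (\<lambda>s. \<mu> s $ i) t) = riemann_sum (P n) E (M n) t" for n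
      unfolding M_def using riemann_sum_compose[OF fin, of n E "\<lambda>i s. \<theta> s $ i" "\<lambda>i s. \<mu> s $ i" t UNIV] by simp
    moreover have "(\<lambda>n. riemann_sum (P n) E (M n) t) \<longlonglongrightarrow> E t * \<gamma> t - E 0 * \<gamma> 0"
      unfolding E_eq[abs_def]
      using t U \<gamma>_nz by (intro riemann_sums_exp_stieltjes_tendsto[OF partitions _ _ \<gamma>_cont _ _ \<Gamma>_U M_lim] continuous_intros) auto
    ultimately show ?thesis
      unfolding pathwise_integral_vec_def using E_0 by (intro limI) simp
  qed
  have mu_sum: "(\<Sum>i\<in>UNIV. \<mu> t $ i) = 1" if t: "t \<in> {0..T}" for t
    using S_total[rule_format, OF t] by (simp add: mu_eq flip: sum_divide_distrib)
  define R where "R t = (\<Sum>j\<in>UNIV. \<theta> t $ j * \<mu> t $ j)" for t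
  \<comment> \<open>Everything at time 0 cancels because \<open>E 0 = 1\<close>: the initial terms
    of the defect against the sum in \<open>C(0)\<close>, and the two occurrences of
    \<open>\<gamma> 0\<close> against each other.\<close>
  have psi: "\<psi> t $ i = E t * \<theta> t $ i - E t * R t + E t * \<gamma> t" if t: "t \<in> {0..T}" for t i
    using integral[OF t] E_0
    by (simp add: psi_eq multiplicatively_generated_def self_financing_defect_def Let_def R_def
        \<gamma>_def[THEN fun_cong, symmetric] sum_subtractf sum_distrib_left mult.assoc flip: E_def)
  have V: "V t = \<gamma> t * E t" if t: "t \<in> {0..T}" for t
  proof -
    have "V t = (\<Sum>i\<in>UNIV. E t * (\<theta> t $ i * \<mu> t $ i) + (E t * \<gamma> t - E t * R t) * \<mu> t $ i)"
      unfolding V_eq by (intro sum.cong) (simp_all add: psi[OF t] algebra_simps)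
    \<comment> \<open>The part of \<open>\<psi>\<close> common to all coordinates is multiplied by
      the sum of the market weights, which is 1; the terms with \<open>R t\<close> then
      cancel.\<close>
    also have "\<dots> = E t * R t + (E t * \<gamma> t - E t * R t) * 1"
      unfolding sum.distrib R_def by (simp add: mu_sum[OF t] flip: sum_distrib_left)
    finally show ?thesis by simp
  qed
  show ?thesis
  proof (intro conjI allI ballI)
    fix t assume t: "t \<in> {0..T}"
    show "V t = G (\<mu> t) (A t) *
        exp (stieltjes_integral (\<lambda>s. 1 / G (\<mu> s) (A s)) (gamma_process P G \<theta> \<mu> A) t)"
      using V[OF t] by (simp add: E_eq \<gamma>_def \<Gamma>_def)
    show "G (\<mu> t) (A t) *
        exp (stieltjes_integral (\<lambda>s. 1 / G (\<mu> s) (A s)) (gamma_process P G \<theta> \<mu> A) t) > 0"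
      using \<gamma>_pos[OF t] by (simp add: \<gamma>_def)
    show "\<psi> t $ i = V t * (1 + 1 / G (\<mu> t) (A t) * (\<theta> t $ i - (\<Sum>j\<in>UNIV. \<theta> t $ j * \<mu> t $ j)))" for i
      using \<gamma>_nz[OF t] unfolding psi[OF t] V[OF t] R_def[symmetric] \<gamma>_def[symmetric]
      by (simp add: \<gamma>_def field_simps)
  qed
qed

end
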